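(* Let $d\geq 1$ and $n\geq 1$ be integers, let $G$ be a $d$--regular bipartite graph on $v(G)=2n$ vertices, let $0\leq k\leq n$ be an integer, and let $m_k(G)$ denote the number of matchings of size $k$ in $G$. Put $p=\frac{k}{n}$ and $$p_{\mu}={n\choose k}p^k(1-p)^{n-k},$$ the probability that a Binomial$(n,p)$ random variable takes its mean value $k$. Then $$m_k(G)\geq p_{\mu}\exp\big(2n\,\mathcal{G}_d(p)\big).$$ In particular $$m_k(G)\geq {n\choose k}^2\left(\frac{d-p}{d}\right)^{n(d-p)}(dp)^{np}.$$ Furthermore, for every $0\leq k<n$ there exists a $d$--regular bipartite graph $G$ on $2n$ vertices such that, with $p=k/n$, $$m_k(G)\leq \sqrt{\frac{1-p/d}{1-p}}\cdot p_{\mu}\exp\big(2n\,\mathcal{G}_d(p)\big).$$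
   Context: For a positive integer $d$ and $0\leq p\leq 1$, $$\mathcal{G}_d(p)=\frac{1}{2}\left(p\ln\left(\frac{d}{p}\right)+(d-p)\ln\left(1-\frac{p}{d}\right)-2(1-p)\ln(1-p)\right),$$ with the convention $0\ln(\cdot)=0$ (i.e. $0\ln 0=0$, $0\ln(d/0)=0$). A matching of size $k$ is a set of $k$ pairwise vertex-disjoint edges; $m_0(G)=1$. Note the identity ${n\choose k}^2\left(\frac{d-p}{d}\right)^{n(d-p)}(dp)^{np}=p_\mu^2\exp(2n\mathcal{G}_d(p))$. *)

theory Defs
  imports Complex_Main
begin

text \<open>A bipartite multigraph with colour classes L = {0..<n} and R = {0..<n}:
  a finite set of edge names E, each edge e having endpoints ends e = (i, j),
  meaning left vertex i and right vertex j. Multiple edges are allowed.\<close>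

definition bip_regular :: "nat \<Rightarrow> nat \<Rightarrow> nat set \<Rightarrow> (nat \<Rightarrow> nat \<times> nat) \<Rightarrow> bool" where
  "bip_regular n d E ends \<longleftrightarrow>
     finite E \<and>
     (\<forall>e\<in>E. fst (ends e) < n \<and> snd (ends e) < n) \<and>
     (\<forall>i<n. card {e\<in>E. fst (ends e) = i} = d) \<and>
     (\<forall>j<n. card {e\<in>E. snd (ends e) = j} = d)"

definition matchings :: "nat set \<Rightarrow> (nat \<Rightarrow> nat \<times> nat) \<Rightarrow> nat \<Rightarrow> nat set set" where
  "matchings E ends k = {M. M \<subseteq> E \<and> card M = k \<and>
     (\<forall>e\<in>M. \<forall>e'\<in>M. e \<noteq> e' \<longrightarrow>
        fst (ends e) \<noteq> fst (ends e') \<and> snd (ends e) \<noteq> snd (ends e'))}"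

definition num_matchings :: "nat set \<Rightarrow> (nat \<Rightarrow> nat \<times> nat) \<Rightarrow> nat \<Rightarrow> nat" where
  "num_matchings E ends k = card (matchings E ends k)"

definition xln :: "real \<Rightarrow> real \<Rightarrow> real" where
  "xln x y = (if x = 0 then 0 else x * ln y)"

definition Gfun :: "nat \<Rightarrow> real \<Rightarrow> real" where
  "Gfun d p = (1/2) * (xln p (real d / p) + xln (real d - p) (1 - p / real d)
                        - 2 * xln (1 - p) (1 - p))"

definition rpow :: "real \<Rightarrow> real \<Rightarrow> real" where
  "rpow x a = (if x = 0 then (if a = 0 then 1 else 0) else x powr a)"

definition p_mu :: "nat \<Rightarrow> nat \<Rightarrow> real" where
  "p_mu n k = real (n choose k) * (real k / real n) ^ k * (1 - real k / real n) ^ (n - k)"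

end

theory Submission
  imports Defs
    "HOL-Computational_Algebra.Fundamental_Theorem_Algebra"
    "HOL-Combinatorics.Permutations"
    "HOL-Analysis.Harmonic_Numbers"
    "HOL-Library.FuncSet"
begin

text \<open>
  Lower bound, by Gurvits's capacity method. Give the left vertices variables \<open>z\<^sub>i\<close> and adjoin the right
  vertices one at a time to the monomial \<open>\<Prod> z\<^sub>i\<close>: adjoining \<open>j\<close> replaces \<open>f t = F (z + t A\<^sub>j)\<close> by
  \<open>f 0 + f' 0\<close>. This keeps \<open>F\<close> free of zeros in the upper half-plane (the Heilmann--Lieb theorem), so \<open>f\<close>
  is real-rooted of degree at most \<open>d\<close>, and by AM--GM the step loses at most a factor depending on \<open>d\<close>
  and \<open>p\<close> against \<open>inf f t / t\<^sup>p\<close>. Starting from \<open>\<Prod>\<^sub>i (s + \<Sum>\<^sub>j A\<^sub>i\<^sub>j x\<^sub>j)\<close> one gets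
  \<open>\<Sum>\<^sub>r m\<^sub>r s\<^bsup>n-r\<^esup> \<ge> s\<^bsup>n-k\<^esup> exp (2 n G\<^sub>d(p))\<close>. The left-hand side is real-rooted in \<open>s\<close>, and
  differentiating it \<open>n - k\<close> times, with the same capacity estimate at each step, isolates \<open>m\<^sub>k\<close> and
  produces the factor \<open>p\<^sub>\<mu>\<close>.

  Upper bound: in the configuration model the expected number of \<open>k\<close>-matchings is
  \<open>(n choose k)\<^sup>2 d\<^bsup>2k\<^esup> / (nd choose k)\<close>. It remains to see that \<open>sqrt (1 - k/N)\<close> times the probability
  that a Binomial\<open>(N, k/N)\<close> variable equals \<open>k\<close> increases with \<open>N\<close>; this is applied to \<open>N = n\<close> and \<open>N = nd\<close>.
\<close>

section \<open>Stable polynomials\<close>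

text \<open>The positive reals are included so that shifts \<open>w + t a\<close> with \<open>w > 0\<close>, \<open>a \<ge> 0\<close> stay in the set
  even where \<open>a\<close> vanishes; no limit argument is then needed.\<close>

definition uhp :: "complex set" where
  "uhp = {z. Im z > 0 \<or> (Im z = 0 \<and> Re z > 0)}"

definition stable :: "complex poly \<Rightarrow> bool" where
  "stable f \<longleftrightarrow> (\<forall>z\<in>uhp. poly f z \<noteq> 0)"

lemma uhp_nonzero: "z \<in> uhp \<Longrightarrow> z \<noteq> 0"
  by (auto simp: uhp_def)

lemma uhp_add: "z \<in> uhp \<Longrightarrow> w \<in> uhp \<Longrightarrow> z + w \<in> uhp"
  by (auto simp: uhp_def)

lemma uhp_add_mult_of_nat: "z \<in> uhp \<Longrightarrow> w \<in> uhp \<Longrightarrow> z + w * of_nat m \<in> uhp"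
  by (cases "m = 0") (auto simp: uhp_def add_pos_nonneg add_nonneg_pos)

lemma uhp_of_real: "x > 0 \<Longrightarrow> complex_of_real x \<in> uhp"
  by (auto simp: uhp_def)

lemma uhp_sum:
  assumes "finite S" "S \<noteq> {}" "\<And>i. i \<in> S \<Longrightarrow> g i \<in> uhp"
  shows "sum g S \<in> uhp"
  using assms by (induction S rule: finite_ne_induct) (auto intro: uhp_add)

text \<open>The number equals \<open>- z / |z|^2\<close>, and a nonzero point outside
  \<open>uhp\<close> has its negative in \<open>uhp\<close>.\<close>

lemma cnj_minus_inverse_uhp:
  assumes "z \<noteq> 0" "z \<notin> uhp"
  shows "cnj (- (1 / z)) \<in> uhp"
proof -
  have "(Re z)\<^sup>2 + (Im z)\<^sup>2 > 0"
    using assms(1) by (metis complex_eq_iff sum_power2_gt_zero_iff zero_complex.simps)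
  moreover have "Im z < 0 \<or> (Im z = 0 \<and> Re z < 0)"
    using assms by (auto simp: uhp_def complex_eq_iff not_less less_eq_real_def)
  ultimately show ?thesis
    by (auto simp: uhp_def Im_divide Re_divide divide_less_0_iff zero_less_divide_iff)
qed

section \<open>Factorization at zero and the ratio of the two lowest coefficients\<close>

lemma prod_const_poly: "(\<Prod>i\<in>S. [:g i:]) = [:\<Prod>i\<in>S. g i:]" for g :: "'a \<Rightarrow> 'b::comm_semiring_1"
  by (induction S rule: infinite_finite_induct) (auto simp: one_pCons mult.commute)

text \<open>The factors are normalised at 0 rather than at infinity: \<open>r i\<close> is minus the
  reciprocal of a root, so that \<open>coeff f 1 / coeff f 0\<close> becomes the sum of the
  \<open>r i\<close>.\<close>

lemma complex_poly_factor_at_0: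
  fixes f :: "complex poly"
  assumes "poly f 0 \<noteq> 0"
  obtains r where "f = smult (poly f 0) (\<Prod>i<degree f. [:1, r i:])"
    and "\<And>i. i < degree f \<Longrightarrow> r i \<noteq> 0 \<and> poly f (- (1 / r i)) = 0"
proof -
  obtain root where root: "smult (lead_coeff f) (\<Prod>i<degree f. [:-root i, 1:]) = f"
    using complex_poly_decompose' by blast
  have rt: "poly f (root i) = 0" if "i < degree f" for i
    by (subst root[symmetric]) (use that in \<open>auto simp: poly_prod\<close>)
  then have nz: "root i \<noteq> 0" if "i < degree f" for i
    using that assms by metis
  define r where "r = (\<lambda>i. - (1 / root i))"
  have "(\<Prod>i<degree f. [:-root i, 1:]) = (\<Prod>i<degree f. [:- root i:] * [:1, r i:])"
    by (rule prod.cong) (auto simp: r_def nz)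
  also have "\<dots> = [:\<Prod>i<degree f. - root i:] * (\<Prod>i<degree f. [:1, r i:])"
    unfolding prod.distrib by (simp only: prod_const_poly)
  finally have *: "f = smult (lead_coeff f * (\<Prod>i<degree f. - root i)) (\<Prod>i<degree f. [:1, r i:])"
    using root by simp
  have "poly f 0 = lead_coeff f * (\<Prod>i<degree f. - root i)"
    by (subst *) (simp add: poly_prod)
  with * have "f = smult (poly f 0) (\<Prod>i<degree f. [:1, r i:])" by simp
  moreover have "r i \<noteq> 0 \<and> poly f (- (1 / r i)) = 0" if "i < degree f" for i
    using nz[OF that] rt[OF that] by (simp add: r_def)
  ultimately show ?thesis using that by blast
qed

lemma coeff_prod_linear:
  fixes r :: "'a \<Rightarrow> 'b::comm_ring_1"
  assumes "finite S"
  shows "coeff (\<Prod>i\<in>S. [:1, r i:]) 0 = 1 \<and> coeff (\<Prod>i\<in>S. [:1, r i:]) 1 = (\<Sum>i\<in>S. r i)"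
  using assms by (induction S rule: finite_induct) (auto simp: coeff_pCons algebra_simps)

text \<open>By \<open>cnj_minus_inverse_uhp\<close> every \<open>cnj (r i)\<close> lies in
  \<open>uhp\<close>, which is closed under nonempty sums.\<close>

lemma stable_coeff_1:
  assumes "stable f" "poly f 0 \<noteq> 0"
  shows "degree f = 0 \<or> cnj (coeff f 1 / coeff f 0) \<in> uhp"
proof (cases "degree f = 0")
  case False
  obtain r where r: "f = smult (poly f 0) (\<Prod>i<degree f. [:1, r i:])"
    and rt: "\<And>i. i < degree f \<Longrightarrow> r i \<noteq> 0 \<and> poly f (- (1 / r i)) = 0"
    using complex_poly_factor_at_0[OF assms(2)] by metis
  have "cnj (r i) \<in> uhp" if "i < degree f" for i
    using cnj_minus_inverse_uhp[of "- (1 / r i)"] rt[OF that] assms(1) by (auto simp: stable_def)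
  then have "(\<Sum>i<degree f. cnj (r i)) \<in> uhp"
    using False by (intro uhp_sum) auto
  moreover have "coeff f 1 / coeff f 0 = (\<Sum>i<degree f. r i)"
    using assms(2) by (subst (1 2) r) (simp add: coeff_prod_linear del: One_nat_def)
  ultimately show ?thesis by simp
qed simp

text \<open>For nonconstant \<open>f\<close> a vanishing sum would make the ratio in
  \<open>stable_coeff_1\<close> equal to -1, which lies outside \<open>uhp\<close>.\<close>

lemma stable_coeff_0_plus_1:
  assumes "stable f" "poly f 0 \<noteq> 0"
  shows "coeff f 0 + coeff f 1 \<noteq> 0"
proof
  assume s: "coeff f 0 + coeff f 1 = 0"
  have c0: "coeff f 0 \<noteq> 0" using assms(2) by (simp add: poly_0_coeff_0)
  from stable_coeff_1[OF assms] show False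
  proof
    assume "degree f = 0"
    then have "coeff f 1 = 0" by (simp add: coeff_eq_0)
    with s c0 show False by simp
  next
    assume "cnj (coeff f 1 / coeff f 0) \<in> uhp"
    moreover have "coeff f 1 = - coeff f 0" using s by (simp add: add_eq_0_iff)
    then have "coeff f 1 / coeff f 0 = - 1" using c0 by simp
    ultimately show False by (simp only: uhp_def) simp
  qed
qed

lemma stable_shift:
  assumes "stable f" "s \<in> uhp"
  shows "stable (pcompose f [:s, 1:])" "poly (pcompose f [:s, 1:]) 0 \<noteq> 0"
  using assms by (auto simp: stable_def poly_pcompose intro: uhp_add)

lemma coeff_1_shift: "coeff (pcompose f [:s, 1:]) 1 = poly (pderiv f) s"
  for f :: "'a :: {comm_ring_1,semiring_no_zero_divisors} poly"
proof -
  have "coeff (pderiv (pcompose f [:s, 1:])) 0 = poly (pderiv f) s"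
    by (simp add: pderiv_pcompose pderiv_pCons poly_pcompose flip: poly_0_coeff_0)
  then show ?thesis by (simp add: coeff_pderiv)
qed

text \<open>Gauss--Lucas for \<open>uhp\<close>: once \<open>z\<close> is moved to 0,
  \<open>stable_coeff_1\<close> keeps the logarithmic derivative away from 0.\<close>

lemma stable_pderiv:
  assumes "stable f" "degree f > 0"
  shows "stable (pderiv f)"
  unfolding stable_def
proof
  fix z assume z: "z \<in> uhp"
  let ?g = "pcompose f [:z, 1:]"
  have "degree ?g = degree f" by (simp add: degree_pcompose)
  then have "cnj (coeff ?g 1 / coeff ?g 0) \<in> uhp"
    using stable_coeff_1[OF stable_shift[OF assms(1) z]] assms(2) by auto
  then have "coeff ?g 1 \<noteq> 0" by (auto simp: uhp_def)
  then show "poly (pderiv f) z \<noteq> 0" unfolding coeff_1_shift .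
qed

section \<open>The multivariate matching polynomial\<close>

text \<open>\<open>match_poly A js L z\<close> sums \<open>\<Prod> z\<^sub>i\<close> over the unmatched \<open>i \<in> L\<close>, for all matchings between \<open>L\<close> and \<open>js\<close>
  in the multigraph with edge multiplicities \<open>A j i\<close>.\<close>

fun match_poly :: "('r \<Rightarrow> 'l \<Rightarrow> nat) \<Rightarrow> 'r list \<Rightarrow> 'l set \<Rightarrow> ('l \<Rightarrow> 'a::comm_semiring_1) \<Rightarrow> 'a" where
  "match_poly A [] L z = prod z L"
| "match_poly A (j # js) L z =
     match_poly A js L z + (\<Sum>i\<in>L. of_nat (A j i) * match_poly A js (L - {i}) z)"

text \<open>One induction serves both the evaluation of polynomials and the passage from real to
  complex coefficients.\<close>

lemma match_poly_hom:
  fixes A :: "'r \<Rightarrow> 'l \<Rightarrow> nat" and h :: "'a::comm_semiring_1 \<Rightarrow> 'b::comm_semiring_1"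
  assumes add: "\<And>x y. h (x + y) = h x + h y" and mult: "\<And>x y. h (x * y) = h x * h y"
    and zero: "h 0 = 0" and one: "h 1 = 1"
  shows "h (match_poly A js L z) = match_poly A js L (\<lambda>i. h (z i))"
proof (induction js arbitrary: L)
  case Nil
  have "h (prod z L) = (\<Prod>i\<in>L. h (z i))"
    by (induction L rule: infinite_finite_induct) (auto simp: one mult)
  then show ?case by simp
next
  case (Cons j js)
  have nat: "h (of_nat k) = of_nat k" for k by (induction k) (auto simp: add zero one)
  have sum: "h (sum g S) = (\<Sum>i\<in>S. h (g i))" for g and S :: "'l set"
    by (induction S rule: infinite_finite_induct) (auto simp: zero add)
  show ?case by (simp add: add mult sum nat Cons)
qed

lemma poly_match_poly:
  "poly (match_poly A js L z) t = match_poly A js L (\<lambda>i. poly (z i) t)"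
  by (rule match_poly_hom[where h = "\<lambda>f. poly f t"]) auto

lemma map_poly_of_real_match_poly:
  "map_poly complex_of_real (match_poly A js L z) = match_poly A js L (\<lambda>i. map_poly complex_of_real (z i))"
  by (rule match_poly_hom) (auto intro!: poly_eqI simp: coeff_map_poly coeff_mult)

lemma coeff_1_mult: "coeff (f * g) 1 = coeff f 0 * coeff g 1 + coeff f 1 * coeff g 0"
  by (simp add: coeff_mult atMost_Suc add.commute)

text \<open>Each \<open>z\<^sub>i\<close> occurs to degree at most one, and differentiating by it
  deletes \<open>i\<close> from \<open>L\<close>; this is the derivative at \<open>w\<close> in the
  direction \<open>b\<close>.\<close>

lemma coeff_1_match_poly:
  fixes w :: "'l \<Rightarrow> 'a::comm_ring_1"
  assumes "finite L"
  shows "coeff (match_poly A js L (\<lambda>i. [:w i, of_nat (b i):])) 1 =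
           (\<Sum>i\<in>L. of_nat (b i) * match_poly A js (L - {i}) w)"
  using assms
proof (induction js arbitrary: L)
  case Nil
  then show ?case
  proof (induction L rule: finite_induct)
    case (insert x F)
    have "(\<Sum>i\<in>F. of_nat (b i) * prod w (insert x F - {i})) = w x * (\<Sum>i\<in>F. of_nat (b i) * prod w (F - {i}))"
      unfolding sum_distrib_left
    proof (rule sum.cong)
      fix i assume "i \<in> F"
      then have "insert x F - {i} = insert x (F - {i})" using insert by auto
      then show "of_nat (b i) * prod w (insert x F - {i}) = w x * (of_nat (b i) * prod w (F - {i}))"
        using insert by (simp add: algebra_simps)
    qed simp
    moreover have "coeff (\<Prod>i\<in>F. [:w i, of_nat (b i):]) 0 = prod w F"
      by (simp add: poly_prod flip: poly_0_coeff_0)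
    moreover have "insert x F - {x} = F" using insert by auto
    ultimately show ?case using insert
      by (simp add: coeff_1_mult del: One_nat_def mult_pCons_left) (simp add: algebra_simps)
  qed auto
next
  case (Cons j js)
  let ?M = "\<lambda>L. match_poly A js L w"
  let ?P = "\<lambda>L. match_poly A js L (\<lambda>i. [:w i, of_nat (b i):])"
  have c: "coeff (of_nat m * g) 1 = of_nat m * coeff g 1" for m and g :: "'a poly"
    by (simp add: of_nat_poly)
  \<comment> \<open>Both sides run over ordered pairs of distinct left vertices, one matched to
    \<open>j\<close> and one removed by differentiation.\<close>
  have swap: "(\<Sum>i\<in>L. \<Sum>k\<in>L - {i}. of_nat (A j i) * (of_nat (b k) * ?M (L - {i} - {k}))) =
      (\<Sum>k\<in>L. \<Sum>i\<in>L - {k}. of_nat (b k) * (of_nat (A j i) * ?M (L - {k} - {i})))"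
  proof -
    have "(\<Sum>i\<in>L. \<Sum>k\<in>L - {i}. of_nat (A j i) * (of_nat (b k) * ?M (L - {i} - {k}))) =
      (\<Sum>i\<in>L. \<Sum>k | k \<in> L \<and> i \<noteq> k. of_nat (A j i) * (of_nat (b k) * ?M (L - {i} - {k})))"
      by (intro sum.cong) auto
    also have "\<dots> = (\<Sum>k\<in>L. \<Sum>i | i \<in> L \<and> i \<noteq> k. of_nat (A j i) * (of_nat (b k) * ?M (L - {i} - {k})))"
      using Cons.prems by (rule sum.swap_restrict[OF _ Cons.prems])
    also have "\<dots> = (\<Sum>k\<in>L. \<Sum>i\<in>L - {k}. of_nat (b k) * (of_nat (A j i) * ?M (L - {k} - {i})))"
      by (intro sum.cong) (auto simp: mult.left_commute Diff_insert2[symmetric] insert_commute)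
    finally show ?thesis .
  qed
  have "coeff (match_poly A (j # js) L (\<lambda>i. [:w i, of_nat (b i):])) 1 =
      coeff (?P L) 1 + (\<Sum>i\<in>L. of_nat (A j i) * coeff (?P (L - {i})) 1)"
    by (simp only: match_poly.simps coeff_add coeff_sum c)
  also have "coeff (?P L) 1 + (\<Sum>i\<in>L. of_nat (A j i) * coeff (?P (L - {i})) 1) =
      (\<Sum>k\<in>L. of_nat (b k) * ?M (L - {k})) +
      (\<Sum>i\<in>L. \<Sum>k\<in>L - {i}. of_nat (A j i) * (of_nat (b k) * ?M (L - {i} - {k})))"
    using Cons.prems by (simp only: Cons.IH finite_Diff sum_distrib_left)
  also have "\<dots> = (\<Sum>k\<in>L. of_nat (b k) * match_poly A (j # js) (L - {k}) w)"
    unfolding swap by (simp add: sum.distrib distrib_left sum_distrib_left)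
  finally show ?case .
qed

text \<open>A vertex with \<open>b i = 0\<close> carries a constant polynomial. For
  \<open>b = A j\<close> the bound is the degree of the right vertex \<open>j\<close>.\<close>

lemma degree_match_poly:
  fixes w :: "'l \<Rightarrow> 'a::comm_ring_1"
  assumes "finite L"
  shows "degree (match_poly A js L (\<lambda>i. [:w i, of_nat (b i):])) \<le> (\<Sum>i\<in>L. b i)"
  using assms
proof (induction js arbitrary: L)
  case Nil
  have "degree (\<Prod>i\<in>L. [:w i, of_nat (b i):]) \<le> (\<Sum>i\<in>L. degree [:w i, of_nat (b i):])"
    using degree_prod_sum_le[OF Nil, of "\<lambda>i. [:w i, of_nat (b i):]"] by (simp add: o_def)
  also have "\<dots> \<le> (\<Sum>i\<in>L. b i)" by (rule sum_mono) (auto simp: Suc_le_eq intro: gr0I)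
  finally show ?case by simp
next
  case (Cons j js)
  let ?P = "\<lambda>L. match_poly A js L (\<lambda>i. [:w i, of_nat (b i):])"
  have "degree (of_nat (A j i) * ?P (L - {i})) \<le> (\<Sum>i\<in>L. b i)" if "i \<in> L" for i
  proof -
    have "degree (of_nat (A j i) * ?P (L - {i})) \<le> degree (?P (L - {i}))"
      by (simp add: of_nat_poly degree_smult_le)
    also have "\<dots> \<le> (\<Sum>i\<in>L - {i}. b i)" using Cons by simp
    also have "\<dots> \<le> (\<Sum>i\<in>L. b i)" using Cons.prems by (intro sum_mono2) auto
    finally show ?thesis .
  qed
  then show ?case using Cons
    by (auto intro!: degree_add_le degree_sum_le)
qed

text \<open>The value at 0 collects the matchings that leave \<open>j\<close> free; the derivative
  along \<open>A j\<close> chooses a partner for \<open>j\<close>.\<close>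

lemma match_poly_Cons_coeff:
  fixes A :: "'r \<Rightarrow> 'l \<Rightarrow> nat" and j :: 'r and js :: "'r list" and z :: "'l \<Rightarrow> 'a::comm_ring_1"
  assumes "finite L"
  defines "f \<equiv> match_poly A js L (\<lambda>i. [:z i, of_nat (A j i):])"
  shows "match_poly A (j # js) L z = coeff f 0 + coeff f 1"
  unfolding f_def coeff_1_match_poly[OF assms(1)] by (simp add: poly_match_poly flip: poly_0_coeff_0)

text \<open>Heilmann--Lieb: shifting along \<open>A j\<close> stays in \<open>uhp\<close>, so by
  induction the polynomial in \<open>t\<close> is stable and its two lowest coefficients cannot
  cancel.\<close>

lemma match_poly_nonzero_uhp:
  assumes "finite L" "\<And>i. i \<in> L \<Longrightarrow> z i \<in> uhp"
  shows "match_poly A js L z \<noteq> (0 :: complex)"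
  using assms(2)
proof (induction js arbitrary: z)
  case Nil
  then show ?case using uhp_nonzero assms(1) by auto
next
  case (Cons j js)
  let ?f = "match_poly A js L (\<lambda>i. [:z i, of_nat (A j i):])"
  \<comment> \<open>The point 0 lies outside \<open>uhp\<close> but is covered too, since
    \<open>stable_coeff_0_plus_1\<close> asks for a nonzero constant term.\<close>
  have "poly ?f t \<noteq> 0" if "t \<in> uhp \<or> t = 0" for t
    unfolding poly_match_poly
  proof (rule Cons.IH)
    show "poly [:z i, of_nat (A j i):] t \<in> uhp" if "i \<in> L" for i
      using \<open>t \<in> uhp \<or> t = 0\<close> Cons.prems[OF that] by (auto intro: uhp_add_mult_of_nat)
  qed
  then show ?case
    unfolding match_poly_Cons_coeff[OF assms(1)]
    by (intro stable_coeff_0_plus_1) (auto simp: stable_def)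
qed

section \<open>Capacity of real-rooted polynomials\<close>

lemma negative_real_if_notin_uhp:
  assumes "z \<noteq> 0" "z \<notin> uhp" "cnj z \<notin> uhp"
  shows "Im z = 0" "Re z < 0"
  using assms by (auto simp: uhp_def complex_eq_iff)

text \<open>Roots of a real polynomial come in conjugate pairs. Stability keeps both members out of
  \<open>uhp\<close>, which forces every root onto the negative axis.\<close>

lemma stable_real_factor:
  fixes f :: "real poly"
  assumes st: "stable (map_poly complex_of_real f)" and f0: "poly f 0 > 0"
  obtains r where "\<And>i. i < degree f \<Longrightarrow> r i > 0"
    and "f = smult (poly f 0) (\<Prod>i<degree f. [:1, r i:])"
proof -
  let ?f = "map_poly complex_of_real f"
  have ev: "poly ?f (complex_of_real t) = of_real (poly f t)" for t
    by (simp add: poly_altdef coeff_map_poly degree_map_poly)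
  have deg: "degree ?f = degree f" by (simp add: degree_map_poly)
  have "poly ?f 0 \<noteq> 0" using ev[of 0] f0 by simp
  then obtain r where r: "?f = smult (poly ?f 0) (\<Prod>i<degree f. [:1, r i:])"
    and rt: "\<And>i. i < degree f \<Longrightarrow> r i \<noteq> 0 \<and> poly ?f (- (1 / r i)) = 0"
    using complex_poly_factor_at_0[of ?f] unfolding deg by metis
  have real: "r i = of_real (Re (r i)) \<and> Re (r i) > 0" if i: "i < degree f" for i
  proof -
    let ?t = "- (1 / r i)"
    have "poly ?f (cnj ?t) = cnj (poly ?f ?t)"
      by (simp add: poly_cnj map_poly_map_poly o_def)
    then have nu: "?t \<noteq> 0" "?t \<notin> uhp" "cnj ?t \<notin> uhp"
      using rt[OF i] st by (auto simp: stable_def)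
    have "Im ?t = 0" "Re ?t < 0"
      using negative_real_if_notin_uhp[OF nu] by simp_all
    define x where "x = Re ?t"
    have x: "x < 0" using \<open>Re ?t < 0\<close> by (simp only: x_def)
    have t: "?t = of_real x" using \<open>Im ?t = 0\<close> by (simp only: complex_eq_iff x_def) simp
    have "r i = - (1 / ?t)" by simp
    then have "r i = of_real (- (1 / x))" unfolding t by simp
    then show ?thesis using x by simp
  qed
  show ?thesis
  proof
    show "Re (r i) > 0" if "i < degree f" for i using real that by blast
    have "poly f t = poly (smult (poly f 0) (\<Prod>i<degree f. [:1, Re (r i):])) t" for t
    proof -
      have "complex_of_real (poly f t) = poly ?f 0 * (\<Prod>i<degree f. 1 + of_real t * r i)"
        unfolding ev[symmetric] by (subst r) (simp add: poly_prod)
      also have "(\<Prod>i<degree f. 1 + of_real t * r i) = (\<Prod>i<degree f. 1 + of_real t * of_real (Re (r i)))"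
        using real by (intro prod.cong) auto
      also have "poly ?f 0 * \<dots> = of_real (poly f 0 * (\<Prod>i<degree f. 1 + t * Re (r i)))"
        using ev[of 0] by simp
      finally show ?thesis unfolding of_real_eq_iff by (simp add: poly_prod)
    qed
    then show "f = smult (poly f 0) (\<Prod>i<degree f. [:1, Re (r i):])"
      unfolding poly_eq_poly_eq_iff[symmetric] by (rule ext)
  qed
qed

text \<open>Concavity of \<open>ln\<close>, with weight \<open>1 - p\<close> at
  \<open>s / (1 - p)\<close> and weights \<open>p * c j / d\<close> at \<open>d * x j / p\<close>;
  the weights add up to 1. It serves every left vertex and, with a single \<open>x\<close>, the step
  at a right vertex.\<close>

lemma weighted_amgm_ln:
  fixes c x :: "'j \<Rightarrow> real" and p s d :: real
  assumes p: "0 < p" "p \<le> 1" and s: "s > 0" and J: "finite J"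
    and c: "\<And>j. j \<in> J \<Longrightarrow> c j \<ge> 0" and x: "\<And>j. j \<in> J \<Longrightarrow> x j > 0"
    and sum: "(\<Sum>j\<in>J. c j) = d" and d: "d > 0"
  shows "(1 - p) * ln s - xln (1 - p) (1 - p) + p * ln (d / p) + p / d * (\<Sum>j\<in>J. c j * ln (x j))
           \<le> ln (s + (\<Sum>j\<in>J. c j * x j))"
proof -
  define T where "T = s + (\<Sum>j\<in>J. c j * x j)"
  have T: "T > 0" unfolding T_def using s c x by (intro add_pos_nonneg sum_nonneg) (auto intro: mult_nonneg_nonneg less_imp_le)
  \<comment> \<open>The tangent to \<open>ln\<close> at the weighted mean \<open>T\<close>; summed
    with the weights, the terms \<open>y / T - 1\<close> cancel.\<close>
  have tan: "ln y \<le> ln T + y / T - 1" if "y > 0" for y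
    using ln_le_minus_one[of "y / T"] that T by (simp add: ln_div)
  have A: "(1 - p) * ln s - xln (1 - p) (1 - p) \<le> (1 - p) * ln T + s / T - (1 - p)"
  proof (cases "p = 1")
    case True then show ?thesis using s T by (simp add: xln_def)
  next
    case False
    then have q: "1 - p > 0" using p by simp
    have "(1 - p) * ln (s / (1 - p)) \<le> (1 - p) * (ln T + s / (1 - p) / T - 1)"
      using q s by (intro mult_left_mono tan) auto
    moreover have "(1 - p) * (s / (1 - p) / T) = s / T" using q by simp
    ultimately show ?thesis using q s
      by (simp add: xln_def ln_div algebra_simps del: times_divide_eq_right)
  qed
  have "(\<Sum>j\<in>J. p / d * c j * ln (d * x j / p)) \<le> (\<Sum>j\<in>J. p / d * c j * (ln T + d * x j / p / T - 1))"
    using p d c x by (intro sum_mono mult_left_mono tan) auto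
  also have "\<dots> = (\<Sum>j\<in>J. p / d * (ln T - 1) * c j + c j * x j / T)"
    using p d by (intro sum.cong) (auto simp: field_simps)
  also have "\<dots> = p * (ln T - 1) + (T - s) / T"
    using d by (simp add: sum.distrib T_def sum flip: sum_distrib_left sum_divide_distrib)
  also have "(\<Sum>j\<in>J. p / d * c j * ln (d * x j / p)) = (\<Sum>j\<in>J. p / d * ln (d / p) * c j + p / d * (c j * ln (x j)))"
  proof (rule sum.cong)
    fix j assume "j \<in> J"
    then have "ln (d * x j / p) = ln (d / p) + ln (x j)"
      using p d x[of j] by (simp add: ln_div ln_mult)
    then show "p / d * c j * ln (d * x j / p) = p / d * ln (d / p) * c j + p / d * (c j * ln (x j))"
      by (simp add: algebra_simps)
  qed simp
  also have "\<dots> = p * ln (d / p) + p / d * (\<Sum>j\<in>J. c j * ln (x j))"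
    using d by (simp only: sum.distrib sum flip: sum_distrib_left) simp
  finally have "p * ln (d / p) + p / d * (\<Sum>j\<in>J. c j * ln (x j)) \<le> p * (ln T - 1) + (T - s) / T" .
  moreover have "(T - s) / T = 1 - s / T" using T by (simp add: diff_divide_distrib)
  ultimately show ?thesis using A unfolding T_def[symmetric] by (simp add: algebra_simps)
qed

text \<open>AM-GM through \<open>1 + z <= exp z\<close>, applied relative to the mean
  \<open>1 + c\<close>: the exponents add up to 0.\<close>

lemma prod_one_plus_le:
  fixes x :: "nat \<Rightarrow> real" and c :: real
  assumes "n \<le> d" "c \<ge> 0" "\<And>i. i < n \<Longrightarrow> x i \<ge> 0" "(\<Sum>i<n. x i) = d * c"
  shows "(\<Prod>i<n. 1 + x i) \<le> (1 + c) ^ d"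
proof -
  \<comment> \<open>Padding with zeros to exactly \<open>d\<close> factors covers polynomials of
    degree below \<open>d\<close>.\<close>
  define y where "y = (\<lambda>i. if i < n then x i else 0)"
  have "(\<Sum>i<d. y i) = (\<Sum>i<n. y i)"
    using assms(1) by (intro sum.mono_neutral_right) (auto simp: y_def)
  then have sy: "(\<Sum>i<d. y i) = d * c" using assms(4) by (simp add: y_def)
  have "(\<Prod>i<n. 1 + x i) = (\<Prod>i<n. 1 + y i)" by (intro prod.cong) (auto simp: y_def)
  also have "\<dots> = (\<Prod>i<d. 1 + y i)"
    using assms(1) by (intro prod.mono_neutral_left) (auto simp: y_def)
  also have "\<dots> \<le> (\<Prod>i<d. (1 + c) * exp ((y i - c) / (1 + c)))"
  proof (intro prod_mono conjI)
    fix i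
    show "0 \<le> 1 + y i" using assms(3)[of i] by (auto simp: y_def)
    have "(1 + y i) / (1 + c) = 1 + (y i - c) / (1 + c)" using assms(2) by (simp add: field_simps)
    then have "(1 + y i) / (1 + c) \<le> exp ((y i - c) / (1 + c))" by simp
    then show "1 + y i \<le> (1 + c) * exp ((y i - c) / (1 + c))"
      using assms(2) by (simp add: field_simps)
  qed
  also have "\<dots> = (1 + c) ^ d * exp ((\<Sum>i<d. y i - c) / (1 + c))"
    by (simp add: prod.distrib exp_sum sum_divide_distrib)
  also have "(\<Sum>i<d. y i - c) = 0" using sy by (simp add: sum_subtractf)
  finally show ?thesis by simp
qed

text \<open>Here \<open>f t\<close> is \<open>coeff f 0\<close> times a product of factors
  \<open>1 + t * r i\<close> with \<open>u\<close> the sum of the \<open>r i\<close>, so AM-GM gives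
  at most \<open>coeff f 0 * (1 + t * u / d) ^ d\<close>. The claim is the hypothesis at the
  \<open>t\<close> that minimises \<open>(1 + t * u / d) ^ d / t powr p\<close>.\<close>

lemma stable_capacity:
  fixes f :: "real poly" and d :: nat and p B :: real
  assumes st: "stable (map_poly complex_of_real f)" and f0: "poly f 0 > 0"
    and deg: "degree f \<le> d" and d: "d \<ge> 1" and p: "0 < p" "p \<le> 1"
    and B: "\<And>t. t > 0 \<Longrightarrow> B * t powr p \<le> poly f t"
  defines "u \<equiv> coeff f 1 / coeff f 0"
  shows "u \<ge> 0" and "B * (p powr p * exp (xln (d - p) (1 - p / d))) \<le> coeff f 0 * u powr p"
proof -
  obtain r where r: "\<And>i. i < degree f \<Longrightarrow> r i > 0"
    and fr: "f = smult (poly f 0) (\<Prod>i<degree f. [:1, r i:])"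
    using stable_real_factor[OF st f0] by blast
  have f0': "coeff f 0 > 0" using f0 by (simp add: poly_0_coeff_0)
  have u: "u = (\<Sum>i<degree f. r i)"
    unfolding u_def using f0 by (subst (1 2) fr) (simp add: coeff_prod_linear del: One_nat_def)
  then show u0: "u \<ge> 0" using r by (auto intro!: sum_nonneg dest: less_imp_le)
  have ev: "poly f t = coeff f 0 * (\<Prod>i<degree f. 1 + t * r i)" for t
    by (subst fr) (simp add: poly_prod poly_0_coeff_0)
  have pd: "p \<le> d" using d p by linarith
  show "B * (p powr p * exp (xln (d - p) (1 - p / d))) \<le> coeff f 0 * u powr p"
  proof (cases "B \<le> 0")
    case True
    have "B * (p powr p * exp (xln (d - p) (1 - p / d))) \<le> 0" using True by (intro mult_nonpos_nonneg) auto
    also have "0 \<le> coeff f 0 * u powr p" using f0' by simp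
    finally show ?thesis .
  next
    case False
    then have Bp: "B > 0" by simp
    show ?thesis
    proof (cases "p = d")
      \<comment> \<open>Here the minimiser escapes to infinity; \<open>f\<close> is linear and its
        slope is compared with \<open>B\<close> directly.\<close>
      case True
      then have d1: "d = 1" "p = 1" using p d by auto
      have pf: "poly f t = coeff f 0 + coeff f 1 * t" for t
      proof -
        have feq: "f = [:coeff f 0, coeff f 1:]"
        proof (rule poly_eqI)
          fix n
          show "coeff f n = coeff [:coeff f 0, coeff f 1:] n"
            using deg d1(1) coeff_eq_0[of f n] by (auto simp: coeff_pCons split: nat.split)
        qed
        show ?thesis using arg_cong[OF feq, of "\<lambda>g. poly g t"] by (simp add: mult.commute)
      qed
      have "B \<le> coeff f 1"
      proof (rule ccontr)
        assume "\<not> ?thesis"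
        then have g: "B - coeff f 1 > 0" by simp
        \<comment> \<open>At this \<open>t\<close> the value \<open>B * t\<close> exceeds
          \<open>coeff f 0 + coeff f 1 * t\<close> by 1.\<close>
        define t where "t = (coeff f 0 + 1) / (B - coeff f 1)"
        have "t > 0" using g f0' by (simp add: t_def)
        then have "B * t \<le> coeff f 0 + coeff f 1 * t" using B[of t] d1 pf by simp
        moreover have "(B - coeff f 1) * t = coeff f 0 + 1" using g by (simp add: t_def)
        ultimately show False by (simp add: algebra_simps)
      qed
      then show ?thesis using d1 u0 f0' by (simp add: xln_def u_def)
    next
      case False
      then have dp: "d - p > 0" using pd by simp
      have up: "u > 0"
      proof (rule ccontr)
        assume "\<not> ?thesis"
        then have "u = 0" using u0 by simp
        have "degree f = 0"
        proof (rule ccontr)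
          assume "degree f \<noteq> 0"
          then have "(\<Sum>i<degree f. r i) > 0" using r by (intro sum_pos) auto
          then show False using u \<open>u = 0\<close> by simp
        qed
        then have cst: "poly f t = coeff f 0" for t using ev by simp
        \<comment> \<open>Chosen so that \<open>B * t powr p = coeff f 0 + 1\<close>, too much for a
          constant \<open>f\<close>.\<close>
        define t where "t = ((coeff f 0 + 1) / B) powr (1 / p)"
        have "t > 0" using Bp f0' by (simp add: t_def)
        moreover have "t powr p = (coeff f 0 + 1) / B"
          using p Bp f0' by (simp add: t_def powr_powr)
        ultimately show False using B[of t] cst Bp by simp
      qed
      \<comment> \<open>At the minimiser, \<open>c\<close> is the common value
        \<open>t * u / d\<close>.\<close>
      define c where "c = p / (d - p)"
      define t where "t = d * c / u"
      have c: "c > 0" using p dp by (simp add: c_def)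
      have t: "t > 0" using c up d by (simp add: t_def)
      have "(\<Prod>i<degree f. 1 + t * r i) \<le> (1 + c) ^ d"
      proof (rule prod_one_plus_le)
        show "(\<Sum>i<degree f. t * r i) = d * c"
          using up unfolding sum_distrib_left[symmetric] u[symmetric] by (simp add: t_def)
      qed (use deg c t r in \<open>auto intro: less_imp_le mult_nonneg_nonneg\<close>)
      then have le: "B * t powr p \<le> coeff f 0 * (1 + c) ^ d"
        using B[OF t] ev[of t] f0' by (smt (verit) mult_left_mono)
      define q where "q = 1 - p / d"
      have q: "q > 0" using dp d by (simp add: q_def field_simps)
      have qc: "q * (1 + c) = 1" using dp d by (simp add: q_def c_def field_simps)
      \<comment> \<open>Splitting \<open>p\<close> this way recovers \<open>B * t powr p\<close>,
        and the remaining \<open>q ^ d\<close> cancels \<open>(1 + c) ^ d\<close>.\<close>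
      have "p = t * u * q" using dp d up p by (simp add: t_def q_def c_def field_simps)
      then have "p powr p = t powr p * u powr p * q powr p"
        using t up q by (metis powr_mult)
      moreover have "exp (xln (d - p) (1 - p / d)) = q powr (d - p)"
        using dp q by (simp add: xln_def powr_def q_def)
      ultimately have "B * (p powr p * exp (xln (d - p) (1 - p / d))) =
          (B * t powr p) * u powr p * (q powr p * q powr (d - p))" by (simp only: ac_simps)
      also have "q powr p * q powr (d - p) = q ^ d"
        using q by (simp add: powr_realpow flip: powr_add)
      also have "(B * t powr p) * u powr p * q ^ d \<le> (coeff f 0 * (1 + c) ^ d) * u powr p * q ^ d"
        using le q by (intro mult_right_mono) auto
      also have "\<dots> = coeff f 0 * u powr p * (q * (1 + c)) ^ d" by (simp add: power_mult_distrib ac_simps)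
      finally show ?thesis by (simp add: qc)
    qed
  qed
qed

text \<open>The sum is \<open>coeff f 0 * (1 + u)\<close>. Weighted AM-GM for \<open>1 + u\<close>
  turns the bound on \<open>u powr p\<close> into one on the sum, and \<open>p powr p\<close>
  cancels.\<close>

lemma stable_capacity_0_plus_1:
  fixes f :: "real poly" and d :: nat and p B :: real
  assumes "stable (map_poly complex_of_real f)" and f0: "poly f 0 > 0"
    and "degree f \<le> d" and "d \<ge> 1" and p: "0 < p" "p \<le> 1"
    and "\<And>t. t > 0 \<Longrightarrow> B * t powr p \<le> poly f t"
  shows "B * exp (xln (d - p) (1 - p / d) - xln (1 - p) (1 - p)) \<le> coeff f 0 + coeff f 1"
proof -
  define u where "u = coeff f 1 / coeff f 0"
  define X where "X = exp (xln (d - p) (1 - p / d))"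
  define Y where "Y = exp (- xln (1 - p) (1 - p))"
  have u: "u \<ge> 0" and le: "B * (p powr p * X) \<le> coeff f 0 * u powr p"
    using stable_capacity[OF assms] by (simp_all add: u_def X_def)
  have f0': "coeff f 0 > 0" using f0 by (simp add: poly_0_coeff_0)
  have amgm: "u powr p * Y \<le> (1 + u) * p powr p"
  proof (cases "u = 0")
    case True
    then show ?thesis using p by simp
  next
    case False
    then have up: "u > 0" using u by simp
    have "- xln (1 - p) (1 - p) + p * ln (1 / p) + p * ln u \<le> ln (1 + u)"
      using weighted_amgm_ln[of p 1 "{()}" "\<lambda>_. 1" "\<lambda>_. u" 1] p up by simp
    then have "p * ln u - xln (1 - p) (1 - p) \<le> ln (1 + u) + p * ln p"
      using p by (simp add: ln_div)
    then have "exp (p * ln u - xln (1 - p) (1 - p)) \<le> exp (ln (1 + u) + p * ln p)" by simp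
    then show ?thesis using up p by (simp add: powr_def Y_def exp_add exp_diff exp_minus field_simps)
  qed
  have "p powr p * (B * X * Y) = B * (p powr p * X) * Y" by simp
  also have "\<dots> \<le> coeff f 0 * u powr p * Y" using le by (intro mult_right_mono) (auto simp: Y_def)
  also have "\<dots> \<le> coeff f 0 * ((1 + u) * p powr p)"
    using amgm f0' by (simp add: mult.assoc)
  also have "\<dots> = p powr p * (coeff f 0 + coeff f 1)" using f0' by (simp add: u_def field_simps)
  finally have "B * X * Y \<le> coeff f 0 + coeff f 1" using p by simp
  then show ?thesis by (simp add: X_def Y_def exp_diff exp_minus field_simps)
qed

text \<open>Gurvits's bound for the derivative at 0, the case \<open>p = 1\<close> of
  \<open>stable_capacity\<close>; for \<open>d = 1\<close> the factor is
  \<open>0 ^ 0 = 1\<close>.\<close>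

lemma stable_capacity_1:
  fixes f :: "real poly" and d :: nat and p B :: real
  assumes st: "stable (map_poly complex_of_real f)" and f0: "poly f 0 > 0"
    and deg: "degree f \<le> d" and d: "d \<ge> 1" 
    and B: "\<And>t. t > 0 \<Longrightarrow> B * t \<le> poly f t"
  shows "B * ((d - 1) / d) ^ (d - 1) \<le> coeff f 1"
proof -
  have "B * (1 powr 1 * exp (xln (real d - 1) (1 - 1 / d))) \<le> coeff f 0 * (coeff f 1 / coeff f 0) powr 1"
    by (rule stable_capacity(2)[OF st f0 deg d]) (use B in auto)
  moreover have "coeff f 1 / coeff f 0 \<ge> 0"
    by (rule stable_capacity(1)[OF st f0 deg d, of 1 B]) (use B in auto)
  moreover have "coeff f 0 > 0" using f0 by (simp add: poly_0_coeff_0)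
  moreover have "exp (xln (real d - 1) (1 - 1 / d)) = ((d - 1) / d) ^ (d - 1)"
  proof (cases "d = 1")
    case False
    then obtain e where e: "d = Suc e" "e > 0" using d by (cases d) auto
    have q: "1 - 1 / real (Suc e) = real e / real (Suc e)" by (simp add: field_simps)
    have "exp (real e * ln (real e / real (Suc e))) = (real e / real (Suc e)) ^ e"
      using e by (simp add: exp_of_nat_mult)
    then show ?thesis unfolding e(1) q using e(2) by (simp add: xln_def)
  qed (simp add: xln_def)
  ultimately show ?thesis by (simp add: zero_le_divide_iff)
qed

section \<open>Capacity of the matching polynomial\<close>

lemma match_poly_pos:
  assumes "finite L" "\<And>i. i \<in> L \<Longrightarrow> w i > (0 :: real)"
  shows "match_poly A js L w > 0"
  using assms
proof (induction js arbitrary: L)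
  case Nil
  then show ?case by (auto intro: prod_pos)
next
  case (Cons j js)
  have "match_poly A js (L - {i}) w \<ge> 0" for i
    using Cons by (intro less_imp_le Cons.IH) auto
  then show ?case using Cons by (auto intro!: add_pos_nonneg sum_nonneg)
qed

text \<open>\<open>w\<close> and \<open>B\<close> vary in the induction: fixing the variable of
  \<open>j\<close> at \<open>t\<close> turns \<open>w\<close> into \<open>w + t * A j\<close> and
  \<open>B\<close> into \<open>B * t powr p\<close>. Each right vertex then costs one factor from
  \<open>stable_capacity_0_plus_1\<close>.\<close>

lemma match_poly_capacity:
  fixes A :: "'r \<Rightarrow> 'l \<Rightarrow> nat" and w :: "'l \<Rightarrow> real" and p B :: real
  assumes L: "finite L" and d: "d \<ge> 1" and p: "0 < p" "p \<le> 1"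
    and "distinct js" and "\<And>j. j \<in> set js \<Longrightarrow> (\<Sum>i\<in>L. A j i) \<le> d"
    and "\<And>i. i \<in> L \<Longrightarrow> w i > 0"
    and "\<And>x :: 'r \<Rightarrow> real. (\<And>j. x j > 0) \<Longrightarrow>
           B * (\<Prod>j\<in>set js. x j powr p) \<le> (\<Prod>i\<in>L. w i + (\<Sum>j\<in>set js. A j i * x j))"
  shows "B * exp (xln (real d - p) (1 - p / d) - xln (1 - p) (1 - p)) ^ length js \<le> match_poly A js L w"
  using assms(5-)
proof (induction js arbitrary: w B)
  case Nil
  show ?case using Nil(4)[of "\<lambda>_. 1"] by simp
next
  case (Cons j js)
  let ?C = "exp (xln (real d - p) (1 - p / d) - xln (1 - p) (1 - p))"
  define f where "f = match_poly A js L (\<lambda>i. [:w i, of_nat (A j i):])"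
  have ev: "poly f t = match_poly A js L (\<lambda>i. w i + t * A j i)" for t
    by (simp add: f_def poly_match_poly)
  have "stable (map_poly complex_of_real f)"
    unfolding stable_def f_def map_poly_of_real_match_poly poly_match_poly using Cons.prems(3)
    by (auto intro!: match_poly_nonzero_uhp[OF L] uhp_add_mult_of_nat uhp_of_real simp: map_poly_pCons)
  moreover have "poly f 0 > 0" unfolding ev using Cons.prems(3) by (intro match_poly_pos[OF L]) simp
  moreover have "degree f \<le> d"
    unfolding f_def using degree_match_poly[OF L, of A js w "A j"] Cons.prems(2)[of j] by simp
  moreover have "(B * ?C ^ length js) * t powr p \<le> poly f t" if t: "t > 0" for t
  proof -
    have "(B * t powr p) * ?C ^ length js \<le> poly f t" unfolding ev
    proof (rule Cons.IH)
      show "distinct js" "\<And>j. j \<in> set js \<Longrightarrow> sum (A j) L \<le> d" using Cons.prems by auto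
      show "w i + t * A j i > 0" if "i \<in> L" for i
        using Cons.prems(3)[OF that] t by (auto intro: add_pos_nonneg)
      fix x :: "'r \<Rightarrow> real" assume x: "\<And>j. x j > 0"
      have j: "j \<notin> set js" using Cons.prems by simp
      have "B * (\<Prod>k\<in>set (j # js). (x(j := t)) k powr p) \<le>
          (\<Prod>i\<in>L. w i + (\<Sum>k\<in>set (j # js). A k i * (x(j := t)) k))"
        by (rule Cons.prems(4)) (use x t in simp)
      moreover have "(\<Prod>k\<in>set js. (x(j := t)) k powr p) = (\<Prod>k\<in>set js. x k powr p)"
        using j by (intro prod.cong) auto
      moreover have "(\<Sum>k\<in>set js. A k i * (x(j := t)) k) = (\<Sum>k\<in>set js. A k i * x k)" for i
        using j by (intro sum.cong) auto
      ultimately show "B * t powr p * (\<Prod>j\<in>set js. x j powr p) \<le>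
          (\<Prod>i\<in>L. w i + t * A j i + (\<Sum>j\<in>set js. A j i * x j))"
        using j by (simp add: mult.assoc mult.commute[of t] add.assoc)
    qed
    then show ?thesis by (simp add: ac_simps)
  qed
  ultimately have "(B * ?C ^ length js) * ?C \<le> coeff f 0 + coeff f 1"
    by (rule stable_capacity_0_plus_1[OF _ _ _ d p])
  then show ?case unfolding match_poly_Cons_coeff[OF L] f_def by (simp add: ac_simps)
qed

text \<open>\<open>weighted_amgm_ln\<close> at each left vertex yields powers of the
  \<open>x j\<close>. As the edges at each right vertex number \<open>d\<close>, every
  \<open>x j\<close> collects the exponent \<open>p\<close> that \<open>match_poly_capacity\<close>
  expects.\<close>

lemma match_poly_regular_bound:
  fixes A :: "nat \<Rightarrow> nat \<Rightarrow> nat" and s :: real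
  assumes d: "d \<ge> 1" and k: "0 < k" "k \<le> n" and s: "s > 0"
    and row: "\<And>i. i < n \<Longrightarrow> (\<Sum>j<n. A j i) = d" and col: "\<And>j. j < n \<Longrightarrow> (\<Sum>i<n. A j i) = d"
  shows "exp (2 * real n * Gfun d (k / n)) * s ^ (n - k) \<le> match_poly A [0..<n] {..<n} (\<lambda>_. s)"
proof -
  define p where "p = real k / n"
  have n: "n > 0" using k by simp
  have p: "0 < p" "p \<le> 1" using k n by (auto simp: p_def)
  \<comment> \<open>\<open>K\<close> is the logarithmic contribution of a left vertex,
    \<open>C\<close> that of a right one;
    \<open>K + C = (1 - p) * ln s + 2 * Gfun d p\<close>.\<close>
  define K where "K = (1 - p) * ln s - xln (1 - p) (1 - p) + p * ln (d / p)"
  define C where "C = xln (real d - p) (1 - p / d) - xln (1 - p) (1 - p)"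
  have sl: "set [0..<n] = {..<n}" by auto
  have "exp (n * K) * exp C ^ length [0..<n] \<le> match_poly A [0..<n] {..<n} (\<lambda>_. s)"
    unfolding C_def
  proof (rule match_poly_capacity[OF _ d p])
    fix x :: "nat \<Rightarrow> real" assume x: "\<And>j. x j > 0"
    have "exp (n * K) * (\<Prod>j<n. x j powr p) = exp (n * K + p * (\<Sum>j<n. ln (x j)))"
      using x by (simp add: exp_add exp_sum sum_distrib_left powr_def less_imp_neq[OF x, symmetric])
    also have "n * K + p * (\<Sum>j<n. ln (x j)) = (\<Sum>i<n. K + p / d * (\<Sum>j<n. A j i * ln (x j)))"
    proof -
      have "(\<Sum>i<n. \<Sum>j<n. A j i * ln (x j)) = (\<Sum>j<n. \<Sum>i<n. A j i * ln (x j))"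
        by (rule sum.swap)
      also have "\<dots> = (\<Sum>j<n. d * ln (x j))"
      proof (rule sum.cong)
        fix j assume "j \<in> {..<n}"
        then have "real (\<Sum>i<n. A j i) = d" using col by simp
        then show "(\<Sum>i<n. A j i * ln (x j)) = d * ln (x j)" by (simp flip: sum_distrib_right)
      qed simp
      finally have *: "(\<Sum>i<n. \<Sum>j<n. A j i * ln (x j)) = d * (\<Sum>j<n. ln (x j))"
        by (simp only: sum_distrib_left)
      have "(\<Sum>i<n. K + p / d * (\<Sum>j<n. A j i * ln (x j))) =
          n * K + p / d * (\<Sum>i<n. \<Sum>j<n. A j i * ln (x j))"
        by (simp only: sum.distrib sum_distrib_left[symmetric]) simp
      then show ?thesis unfolding * using d by simp
    qed
    also have "exp \<dots> = (\<Prod>i<n. exp (K + p / d * (\<Sum>j<n. A j i * ln (x j))))"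
      by (simp add: exp_sum)
    also have "\<dots> \<le> (\<Prod>i<n. s + (\<Sum>j<n. A j i * x j))"
    proof (intro prod_mono conjI)
      fix i assume "i \<in> {..<n}"
      then have r: "(\<Sum>j<n. real (A j i)) = d" using row[of i] by (simp flip: of_nat_sum)
      have "K + p / d * (\<Sum>j<n. A j i * ln (x j)) \<le> ln (s + (\<Sum>j<n. A j i * x j))"
        unfolding K_def using d x by (intro weighted_amgm_ln[OF p s _ _ _ r]) auto
      moreover have "s + (\<Sum>j<n. A j i * x j) > 0"
        using s x by (intro add_pos_nonneg sum_nonneg) (auto intro!: mult_nonneg_nonneg less_imp_le[OF x])
      ultimately show "exp (K + p / d * (\<Sum>j<n. A j i * ln (x j))) \<le> s + (\<Sum>j<n. A j i * x j)"
        by (simp add: ln_ge_iff)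
    qed simp
    finally show "exp (n * K) * (\<Prod>j\<in>set [0..<n]. x j powr p) \<le>
        (\<Prod>i<n. s + (\<Sum>j\<in>set [0..<n]. A j i * x j))" unfolding sl .
  qed (use s col in auto)
  moreover have "exp (n * K) * exp C ^ length [0..<n] = exp (2 * real n * Gfun d p) * s ^ (n - k)"
  proof -
    have "n * p = k" using n by (simp add: p_def)
    then have nk: "real n * (1 - p) = real (n - k)" using k by (simp add: algebra_simps of_nat_diff)
    have "exp (n * K) * exp C ^ length [0..<n] = exp (n * K + n * C)"
      by (simp add: exp_add exp_of_nat_mult)
    also have "n * K + n * C = real n * (1 - p) * ln s + 2 * real n * Gfun d p"
      using p by (simp add: K_def C_def Gfun_def xln_def[of p] algebra_simps)
    also have "exp \<dots> = exp (2 * real n * Gfun d p) * s ^ (n - k)"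
      unfolding nk using s by (simp add: exp_add exp_of_nat_mult)
    finally show ?thesis .
  qed
  ultimately show ?thesis by (simp add: p_def)
qed

section \<open>Isolating a coefficient by repeated differentiation\<close>

lemma amgm_power:
  fixes s t :: real
  assumes "s > 0" "t > 0"
  shows "s ^ m * t * real (Suc m) ^ Suc m \<le> (s + t) ^ Suc m * real m ^ m"
proof (cases "m = 0")
  case False
  define y where "y = t * m / s"
  have y: "y > 0" using assms False by (simp add: y_def)
  \<comment> \<open>Scaling by \<open>m / s\<close> reduces AM-GM for \<open>m\<close> copies of
    \<open>s / m\<close> and one \<open>t\<close> to \<open>m\<close> ones and one \<open>y\<close>;
    Bernoulli's inequality gives that case.\<close>
  have "1 + real (Suc m) * ((y - 1) / Suc m) \<le> (1 + (y - 1) / Suc m) ^ Suc m"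
    using y by (intro Bernoulli_inequality) (simp add: field_simps)
  moreover have "1 + real (Suc m) * ((y - 1) / Suc m) = y" by simp
  moreover have "1 + (y - 1) / Suc m = (m + y) / Suc m" by (simp add: field_simps)
  ultimately have "y \<le> ((m + y) / Suc m) ^ Suc m" by (simp only:)
  then have "y * real (Suc m) ^ Suc m \<le> (m + y) ^ Suc m"
    by (simp add: power_divide pos_le_divide_eq del: power_Suc of_nat_Suc)
  moreover have "m + y = m * (s + t) / s" using assms by (simp add: y_def field_simps)
  ultimately have "y * real (Suc m) ^ Suc m \<le> (m * (s + t) / s) ^ Suc m" by simp
  then have "y * real (Suc m) ^ Suc m * s ^ Suc m \<le> (m * (s + t)) ^ Suc m"
    using assms by (simp add: power_divide pos_le_divide_eq del: power_Suc of_nat_Suc)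
  moreover have "y * real (Suc m) ^ Suc m * s ^ Suc m = m * (s ^ m * t * real (Suc m) ^ Suc m)"
    using assms by (simp add: y_def field_simps)
  moreover have "(m * (s + t)) ^ Suc m = m * ((s + t) ^ Suc m * real m ^ m)"
    by (simp add: power_mult_distrib)
  ultimately show ?thesis using False by (simp del: power_Suc of_nat_Suc)
qed (use assms in simp)

lemma map_poly_of_real_pcompose:
  "map_poly complex_of_real (pcompose f g) = pcompose (map_poly complex_of_real f) (map_poly complex_of_real g)"
proof (induction f)
  case (pCons a f)
  have "map_poly complex_of_real (p + q) = map_poly complex_of_real p + map_poly complex_of_real q"
    "map_poly complex_of_real (p * q) = map_poly complex_of_real p * map_poly complex_of_real q" for p q
    by (auto intro!: poly_eqI simp: coeff_map_poly coeff_mult)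
  then show ?case using pCons by (simp add: pcompose_pCons map_poly_pCons)
qed simp

lemma power_self_pos: "real m ^ m > 0"
  by (cases m) auto

text \<open>Each differentiation lowers both \<open>m\<close> and the degree bound \<open>n\<close>
  by one, and the factors from \<open>stable_capacity_1\<close> and \<open>amgm_power\<close>
  telescope to the displayed constants.\<close>

lemma stable_coeff_bound:
  fixes f :: "real poly" and B :: real
  assumes "stable (map_poly complex_of_real f)" "degree f \<le> n" "m \<le> n" "B > 0"
    and "\<And>t. t > 0 \<Longrightarrow> B * t ^ m \<le> poly f t"
  shows "B * real m ^ m * (fact n / real n ^ n) * (real (n - m) ^ (n - m) / fact (n - m)) \<le> fact m * coeff f m"
  using assms
proof (induction m arbitrary: f n B)
  case 0
  \<comment> \<open>No differentiation is left; \<open>t\<close> tends to 0 from the right.\<close>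
  have "B \<le> poly f 0"
  proof (rule tendsto_lowerbound)
    show "(poly f \<longlongrightarrow> poly f 0) (at_right 0)" by (intro tendsto_intros)
    show "\<forall>\<^sub>F t in at_right 0. B \<le> poly f t"
      using 0(5) by (intro eventually_at_right_less[THEN eventually_mono]) auto
  qed simp
  moreover have "real n ^ n > 0" by (rule power_self_pos)
  ultimately show ?case by (simp add: poly_0_coeff_0)
next
  case (Suc m)
  then obtain n' where n: "n = Suc n'" "m \<le> n'" by (cases n) auto
  \<comment> \<open>A constant \<open>c\<close> cannot dominate \<open>B * t ^ Suc m\<close>; the
    \<open>t\<close> chosen below already gives \<open>B + |c| <= c\<close>.\<close>
  have "degree f > 0"
  proof (rule ccontr)
    assume "\<not> ?thesis"
    then obtain c where c: "f = [:c:]" using degree_eq_zeroE by auto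
    define t where "t = 1 + \<bar>c\<bar> / B"
    have t: "t \<ge> 1" using Suc.prems by (simp add: t_def)
    have "B + \<bar>c\<bar> = B * t" using Suc.prems by (simp add: t_def field_simps)
    also have "\<dots> \<le> B * t ^ Suc m" using t Suc.prems by (intro mult_left_mono self_le_power) auto
    also have "\<dots> \<le> c" using Suc.prems(5)[of t] t c by simp
    finally show False using Suc.prems by simp
  qed
  have pm: "map_poly complex_of_real (pderiv f) = pderiv (map_poly complex_of_real f)"
    by (intro poly_eqI) (simp add: coeff_map_poly coeff_pderiv)
  \<comment> \<open>The first factor comes from \<open>stable_capacity_1\<close> with degree bound
    \<open>n\<close>, the second from \<open>amgm_power\<close>, which bounds
    \<open>(s + t) ^ Suc m\<close> below by a multiple of \<open>t\<close>.\<close>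
  define c where "c = (n' / real (Suc n')) ^ n' * (real (Suc m) ^ Suc m / real m ^ m)"
  have mm: "real m ^ m > 0" "real n' ^ n' > 0" by (rule power_self_pos)+
  have "B * c * s ^ m \<le> poly (pderiv f) s" if s: "s > 0" for s
  proof -
    let ?g = "pcompose f [:s, 1:]"
    have mg: "map_poly complex_of_real ?g = pcompose (map_poly complex_of_real f) [:of_real s, 1:]"
      by (simp add: map_poly_of_real_pcompose map_poly_pCons)
    have pos: "poly f t > 0" if "t > 0" for t
      using Suc.prems(4) Suc.prems(5)[OF that] that by (smt (verit) zero_less_mult_iff zero_less_power)
    have "(B * s ^ m * (real (Suc m) ^ Suc m / real m ^ m)) * ((n - 1) / n) ^ (n - 1) \<le> coeff ?g 1"
    proof (rule stable_capacity_1)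
      show "stable (map_poly complex_of_real ?g)"
        unfolding mg using Suc.prems(1) s by (intro stable_shift uhp_of_real)
      show "poly ?g 0 > 0" using pos s by (simp add: poly_pcompose)
      show "degree ?g \<le> n" using Suc.prems(2) by (simp add: degree_pcompose)
      show "n \<ge> 1" using n by simp
      fix t :: real assume t: "t > 0"
      have "B * s ^ m * (real (Suc m) ^ Suc m / real m ^ m) * t =
          B * (s ^ m * t * real (Suc m) ^ Suc m) / real m ^ m" by (simp add: ac_simps)
      also have "\<dots> \<le> B * ((s + t) ^ Suc m * real m ^ m) / real m ^ m"
        using amgm_power[OF s t, of m] Suc.prems(4) mm by (intro divide_right_mono mult_left_mono) auto
      also have "\<dots> = B * (s + t) ^ Suc m" using mm by simp
      also have "\<dots> \<le> poly f (s + t)" using s t by (intro Suc.prems(5)) simp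
      finally show "B * s ^ m * (real (Suc m) ^ Suc m / real m ^ m) * t \<le> poly ?g t"
        by (simp add: poly_pcompose)
    qed
    then show ?thesis unfolding coeff_1_shift by (simp add: c_def n ac_simps del: of_nat_Suc power_Suc)
  qed
  moreover have "B * c > 0"
  proof -
    have "c > 0" unfolding c_def power_divide using mm by (intro mult_pos_pos divide_pos_pos) auto
    then show ?thesis using Suc.prems(4) by simp
  qed
  moreover have "degree (pderiv f) \<le> n'" using Suc.prems(2) n by (simp add: degree_pderiv)
  ultimately have le: "B * c * real m ^ m * (fact n' / real n' ^ n') * (real (n' - m) ^ (n' - m) / fact (n' - m))
      \<le> fact m * coeff (pderiv f) m"
    using stable_pderiv[OF Suc.prems(1)] \<open>degree f > 0\<close> n
    by (intro Suc.IH) (auto simp: pm degree_map_poly)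
  have eq: "fact m * coeff (pderiv f) m = fact (Suc m) * coeff f (Suc m)"
    by (simp add: coeff_pderiv)
  have eq': "B * c * real m ^ m * (fact n' / real n' ^ n') = B * real (Suc m) ^ Suc m * (fact n / real n ^ n)"
  proof -
    have "fact n / real n ^ n = fact n' / real (Suc n') ^ n'"
      by (simp add: n(1) del: of_nat_Suc)
    then show ?thesis using mm by (simp add: c_def power_divide del: power_Suc of_nat_Suc)
  qed
  have "n - Suc m = n' - m" using n by simp
  then show ?case using le unfolding eq eq' by (simp only:)
qed

section \<open>Counting matchings\<close>

text \<open>Disjointness of edges is injectivity of both endpoint maps; \<open>L\<close> and
  \<open>J\<close> follow the vertex sets in the recursion of \<open>match_poly\<close>.\<close>

definition matchings_within :: "nat set \<Rightarrow> (nat \<Rightarrow> nat \<times> nat) \<Rightarrow> nat set \<Rightarrow> nat set \<Rightarrow> nat set set" where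
  "matchings_within E ends L J = {M. M \<subseteq> E \<and> inj_on (fst \<circ> ends) M \<and> inj_on (snd \<circ> ends) M \<and>
     (\<forall>e\<in>M. fst (ends e) \<in> L \<and> snd (ends e) \<in> J)}"

text \<open>The right vertex comes first, as in the multiplicities \<open>A j i\<close> of
  \<open>match_poly\<close>.\<close>

definition edge_mult :: "nat set \<Rightarrow> (nat \<Rightarrow> nat \<times> nat) \<Rightarrow> nat \<Rightarrow> nat \<Rightarrow> nat" where
  "edge_mult E ends j i = card {e\<in>E. ends e = (i, j)}"

lemma finite_matchings_within: "finite E \<Longrightarrow> finite (matchings_within E ends L J)"
  by (rule finite_subset[of _ "Pow E"]) (auto simp: matchings_within_def)

lemma card_matching_le:
  assumes "M \<in> matchings_within E ends L J" "finite L"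
  shows "card M \<le> card L"
proof -
  have "inj_on (fst \<circ> ends) M" "(fst \<circ> ends) ` M \<subseteq> L" using assms by (auto simp: matchings_within_def)
  then show ?thesis using assms(2) by (metis card_inj_on_le)
qed

text \<open>A matching that covers \<open>j\<close> splits uniquely into its edge at
  \<open>j\<close> and a matching avoiding the left end of that edge.\<close>

lemma matchings_within_insert:
  fixes E L J :: "nat set" and ends :: "nat \<Rightarrow> nat \<times> nat" and j :: nat
  assumes "j \<notin> J"
  defines "S \<equiv> {e\<in>E. snd (ends e) = j \<and> fst (ends e) \<in> L}"
  shows "bij_betw (\<lambda>(e, M). insert e M) (SIGMA e:S. matchings_within E ends (L - {fst (ends e)}) J)
           (matchings_within E ends L (insert j J) - matchings_within E ends L J)"
    (is "bij_betw ?h ?A ?B")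
proof -
  have "inj_on ?h ?A"
  proof (rule inj_onI, clarify)
    fix e M e' M'
    assume a: "e \<in> S" "M \<in> matchings_within E ends (L - {fst (ends e)}) J"
      "e' \<in> S" "M' \<in> matchings_within E ends (L - {fst (ends e')}) J"
      and eq: "insert e M = insert e' M'"
    have "e \<notin> M" "e \<notin> M'" "e' \<notin> M'"
      using a assms by (auto simp: matchings_within_def)
    then show "e = e' \<and> M = M'" using eq by (metis insertE insertI1 insert_ident)
  qed
  moreover have "?h ` ?A = ?B"
  proof (intro equalityI subsetI)
    fix X assume "X \<in> ?h ` ?A"
    then obtain e M where "X = insert e M" "e \<in> S" "M \<in> matchings_within E ends (L - {fst (ends e)}) J"
      by (elim imageE SigmaE) simp
    then have X: "X = insert e M" and e: "e \<in> E" "snd (ends e) = j" "fst (ends e) \<in> L"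
      and M: "M \<subseteq> E" "inj_on (fst \<circ> ends) M" "inj_on (snd \<circ> ends) M"
      and ends: "\<And>e'. e' \<in> M \<Longrightarrow> fst (ends e') \<in> L - {fst (ends e)} \<and> snd (ends e') \<in> J"
      by (auto simp: S_def matchings_within_def)
    have "\<forall>e'\<in>M. fst (ends e) \<noteq> fst (ends e')" "\<forall>e'\<in>M. snd (ends e) \<noteq> snd (ends e')"
      using ends e(2) \<open>j \<notin> J\<close> by (metis DiffE singletonI)+
    then have "(fst \<circ> ends) e \<notin> (fst \<circ> ends) ` M" "(snd \<circ> ends) e \<notin> (snd \<circ> ends) ` M"
      by (simp_all add: image_iff)
    then have "inj_on (fst \<circ> ends) X" "inj_on (snd \<circ> ends) X"
      unfolding X inj_on_insert using M by auto
    moreover have "X \<subseteq> E" "\<forall>e'\<in>X. fst (ends e') \<in> L \<and> snd (ends e') \<in> insert j J"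
      unfolding X using e M(1) ends by blast+
    moreover have "\<not> (\<forall>e'\<in>X. snd (ends e') \<in> J)"
      unfolding X using e(2) \<open>j \<notin> J\<close> by blast
    ultimately show "X \<in> ?B" by (simp add: matchings_within_def)
  next
    fix X assume X: "X \<in> ?B"
    then obtain e where e: "e \<in> X" "snd (ends e) = j" by (auto simp: matchings_within_def)
    have "e \<in> S" using X e by (auto simp: S_def matchings_within_def)
    moreover have "X - {e} \<in> matchings_within E ends (L - {fst (ends e)}) J"
      using X e unfolding matchings_within_def by (auto simp: inj_on_def)
    moreover have "X = insert e (X - {e})" using e by auto
    ultimately show "X \<in> ?h ` ?A" by (auto intro!: image_eqI[of _ _ "(e, X - {e})"])
  qed
  ultimately show ?thesis by (simp add: bij_betw_def)
qed

lemma match_poly_eq_sum_matchings: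
  fixes t :: "'a::comm_semiring_1"
  assumes E: "finite E" and "finite L" "distinct js"
  shows "match_poly (edge_mult E ends) js L (\<lambda>_. t) =
           (\<Sum>M\<in>matchings_within E ends L (set js). t ^ (card L - card M))"
  using assms(2,3)
proof (induction js arbitrary: L)
  case Nil
  have "matchings_within E ends L {} = {{}}" by (auto simp: matchings_within_def)
  then show ?case by simp
next
  case (Cons j js)
  define S where "S = {e\<in>E. snd (ends e) = j \<and> fst (ends e) \<in> L}"
  let ?W = "\<lambda>L. matchings_within E ends L (set js)"
  let ?g = "\<lambda>i. \<Sum>M\<in>?W (L - {i}). t ^ (card (L - {i}) - card M)"
  have j: "j \<notin> set js" using Cons.prems by simp
  have S: "finite S" using E by (simp add: S_def)
  have card: "card L - card (insert e M) = card (L - {fst (ends e)}) - card M"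
    if "e \<in> S" "M \<in> ?W (L - {fst (ends e)})" for e M
  proof -
    have "e \<notin> M" "finite M"
      using that finite_subset[OF _ E] by (auto simp: matchings_within_def)
    then show ?thesis using that(1) Cons.prems by (simp add: S_def)
  qed
  \<comment> \<open>Multiplicities are resolved into the individual edges at \<open>j\<close>,
    grouped by left end.\<close>
  have "(\<Sum>i\<in>L. of_nat (edge_mult E ends j i) * ?g i) = (\<Sum>i\<in>L. \<Sum>e\<in>{e\<in>S. fst (ends e) = i}. ?g (fst (ends e)))"
  proof (rule sum.cong)
    fix i assume "i \<in> L"
    then have "{e\<in>E. ends e = (i, j)} = {e\<in>S. fst (ends e) = i}"
      by (auto simp: S_def prod_eq_iff)
    then show "of_nat (edge_mult E ends j i) * ?g i = (\<Sum>e\<in>{e\<in>S. fst (ends e) = i}. ?g (fst (ends e)))"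
      by (simp add: edge_mult_def)
  qed simp
  also have "\<dots> = (\<Sum>e\<in>S. ?g (fst (ends e)))"
    using S Cons.prems by (intro sum.group) (auto simp: S_def)
  also have "\<dots> = (\<Sum>(e, M)\<in>(SIGMA e:S. ?W (L - {fst (ends e)})). t ^ (card L - card (insert e M)))"
    using S E card by (subst sum.Sigma) (auto simp: finite_matchings_within intro!: sum.cong)
  also have "\<dots> = (\<Sum>X\<in>matchings_within E ends L (insert j (set js)) - ?W L. t ^ (card L - card X))"
    using sum.reindex_bij_betw[OF matchings_within_insert[OF j, of E ends L], of "\<lambda>X. t ^ (card L - card X)"]
    by (simp add: S_def case_prod_unfold)
  finally have *: "(\<Sum>i\<in>L. of_nat (edge_mult E ends j i) * ?g i) =
    (\<Sum>X\<in>matchings_within E ends L (insert j (set js)) - ?W L. t ^ (card L - card X))" .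
  have sub: "?W L \<subseteq> matchings_within E ends L (insert j (set js))" by (auto simp: matchings_within_def)
  have "match_poly (edge_mult E ends) (j # js) L (\<lambda>_. t) = (\<Sum>M\<in>?W L. t ^ (card L - card M)) +
     (\<Sum>i\<in>L. of_nat (edge_mult E ends j i) * ?g i)"
    using Cons by simp
  also have "\<dots> = (\<Sum>X\<in>matchings_within E ends L (insert j (set js)). t ^ (card L - card X))"
    unfolding * using E sub
    by (subst (2) sum.subset_diff[of "?W L"]) (auto simp: finite_matchings_within add.commute)
  finally show ?case by simp
qed

lemma matchings_eq:
  assumes "bip_regular n d E ends"
  shows "matchings E ends k = {M\<in>matchings_within E ends {..<n} {..<n}. card M = k}"
proof (rule set_eqI)
  fix M
  have "\<forall>e\<in>E. fst (ends e) < n \<and> snd (ends e) < n" using assms by (simp add: bip_regular_def)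
  then have "M \<in> matchings_within E ends {..<n} {..<n} \<longleftrightarrow>
      M \<subseteq> E \<and> inj_on (fst \<circ> ends) M \<and> inj_on (snd \<circ> ends) M"
    unfolding matchings_within_def by blast
  moreover have "M \<in> matchings E ends k \<longleftrightarrow>
      M \<subseteq> E \<and> card M = k \<and> inj_on (fst \<circ> ends) M \<and> inj_on (snd \<circ> ends) M"
    unfolding matchings_def inj_on_def o_def by blast
  ultimately show "M \<in> matchings E ends k \<longleftrightarrow> M \<in> {M\<in>matchings_within E ends {..<n} {..<n}. card M = k}"
    by simp blast
qed

lemma sum_edge_mult:
  assumes "bip_regular n d E ends"
  shows "i < n \<Longrightarrow> (\<Sum>j<n. edge_mult E ends j i) = d" "j < n \<Longrightarrow> (\<Sum>i<n. edge_mult E ends j i) = d"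
proof -
  have E: "finite E" "\<And>e. e \<in> E \<Longrightarrow> fst (ends e) < n \<and> snd (ends e) < n"
    using assms by (auto simp: bip_regular_def)
  show "(\<Sum>j<n. edge_mult E ends j i) = d" if "i < n"
  proof -
    have "(\<Sum>j<n. edge_mult E ends j i) = (\<Sum>j<n. \<Sum>e | e \<in> {e\<in>E. fst (ends e) = i} \<and> snd (ends e) = j. 1)"
      unfolding edge_mult_def by (intro sum.cong) (auto simp: prod_eq_iff intro!: arg_cong[where f = card])
    also have "\<dots> = (\<Sum>e\<in>{e\<in>E. fst (ends e) = i}. 1)"
      using E by (intro sum.group) auto
    finally show ?thesis using assms that by (simp add: bip_regular_def)
  qed
  show "(\<Sum>i<n. edge_mult E ends j i) = d" if "j < n"
  proof -
    have "(\<Sum>i<n. edge_mult E ends j i) = (\<Sum>i<n. \<Sum>e | e \<in> {e\<in>E. snd (ends e) = j} \<and> fst (ends e) = i. 1)"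
      unfolding edge_mult_def by (intro sum.cong) (auto simp: prod_eq_iff intro!: arg_cong[where f = card])
    also have "\<dots> = (\<Sum>e\<in>{e\<in>E. snd (ends e) = j}. 1)"
      using E by (intro sum.group) auto
    finally show ?thesis using assms that by (simp add: bip_regular_def)
  qed
qed

text \<open>With all variables equal, \<open>match_poly\<close> is a stable polynomial with
  \<open>m\<^sub>k\<close> at index \<open>n - k\<close>; \<open>match_poly_regular_bound\<close>
  supplies the growth hypothesis of \<open>stable_coeff_bound\<close>.\<close>

lemma num_matchings_lower:
  assumes reg: "bip_regular n d E ends" and d: "d \<ge> 1" and k: "0 < k" "k \<le> n"
  shows "p_mu n k * exp (2 * real n * Gfun d (k / n)) \<le> num_matchings E ends k"
proof -
  let ?A = "edge_mult E ends"
  let ?W = "matchings_within E ends {..<n} {..<n}"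
  have E: "finite E" using reg by (simp add: bip_regular_def)
  have sl: "set [0..<n] = {..<n}" by auto
  define f :: "real poly" where "f = match_poly ?A [0..<n] {..<n} (\<lambda>_. [:0, 1:])"
  define m where "m = n - k"
  have km: "k = n - m" "m \<le> n" "n > 0" using k by (auto simp: m_def)
  have "coeff f m = (\<Sum>M\<in>?W. coeff (monom 1 (n - card M)) m)"
    unfolding f_def match_poly_eq_sum_matchings[OF E finite_lessThan distinct_upt] sl
    by (simp add: coeff_sum monom_altdef)
  also have "\<dots> = (\<Sum>M\<in>?W. if card M = k then 1 else 0)"
    using card_matching_le[of _ E ends "{..<n}"] km by (intro sum.cong) fastforce+
  also have "\<dots> = num_matchings E ends k"
    unfolding num_matchings_def matchings_eq[OF reg] using finite_matchings_within[OF E]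
    by (simp add: sum.If_cases Int_def conj_commute)
  finally have cf: "coeff f m = num_matchings E ends k" .
  have "exp (2 * real n * Gfun d (k / n)) * real m ^ m * (fact n / real n ^ n) * (real (n - m) ^ (n - m) / fact (n - m))
      \<le> fact m * coeff f m"
  proof (rule stable_coeff_bound)
    show "stable (map_poly complex_of_real f)"
      unfolding stable_def f_def map_poly_of_real_match_poly poly_match_poly
      by (intro ballI match_poly_nonzero_uhp) (simp_all add: map_poly_pCons)
    show "degree f \<le> n"
      using degree_match_poly[of "{..<n}" ?A "[0..<n]" "\<lambda>_. 0::real" "\<lambda>_. 1"] by (simp add: f_def)
    show "exp (2 * real n * Gfun d (k / n)) * t ^ m \<le> poly f t" if "t > 0" for t
      using match_poly_regular_bound[OF d k that, of ?A] sum_edge_mult[OF reg]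
      by (simp add: f_def poly_match_poly m_def)
  qed (use km in auto)
  then have le: "exp (2 * real n * Gfun d (k / n)) * (real m ^ m * (fact n / real n ^ n) * (real k ^ k / fact k) / fact m)
      \<le> num_matchings E ends k"
    unfolding cf km(1)[symmetric] times_divide_eq_right[of _ _ "fact m"]
    by (subst pos_divide_le_eq) (simp_all add: ac_simps)
  \<comment> \<open>The constants left by the differentiations are exactly the binomial
    probability.\<close>
  have eq: "real m ^ m * (fact n / real n ^ n) * (real k ^ k / fact k) / fact m = p_mu n k"
  proof -
    have a: "1 - real k / n = m / n" using k by (simp add: m_def of_nat_diff diff_divide_distrib)
    have b: "real n ^ n = real n ^ k * real n ^ m" using k by (simp add: m_def flip: power_add)
    have c: "real (n choose k) = fact n / (fact k * fact m)"
      using k by (simp add: binomial_fact m_def)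
    show ?thesis unfolding p_mu_def m_def[symmetric] a b c by (simp add: power_divide ac_simps)
  qed
  show ?thesis using le unfolding eq by (simp only: mult.commute)
qed

section \<open>The binomial probability of the mean\<close>

text \<open>The derivative is nonpositive because the trapezoidal rule overestimates the integral of
  the convex function \<open>1 / x\<close> over \<open>[z, z + 1]\<close>.\<close>

lemma ln_succ_div_antimono:
  fixes x y :: real
  assumes "0 < x" "x \<le> y"
  shows "(y + 1/2) * (ln (y + 1) - ln y) \<le> (x + 1/2) * (ln (x + 1) - ln x)"
proof (rule DERIV_nonpos_imp_nonincreasing[OF assms(2)])
  fix z assume z: "x \<le> z" "z \<le> y"
  then have zp: "z > 0" using assms by simp
  let ?D = "(ln (z + 1) - ln z) + (z + 1/2) * (1 / (z + 1) - 1 / z)"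
  have "((\<lambda>x. (x + 1/2) * (ln (x + 1) - ln x)) has_real_derivative ?D) (at z)"
    using zp by (auto intro!: derivative_eq_intros)
  moreover have "?D \<le> 0"
  proof -
    have "ln (z + 1) - ln z \<le> 1 * (inverse z + inverse (z + 1)) / 2"
      using ln_inverse_approx_le[of z 1] zp by simp
    also have "\<dots> = - ((z + 1/2) * (1 / (z + 1) - 1 / z))"
      using zp by (simp add: field_simps)
    finally show ?thesis by simp
  qed
  ultimately show "\<exists>D. ((\<lambda>x. (x + 1/2) * (ln (x + 1) - ln x)) has_real_derivative D) (at z) \<and> D \<le> 0"
    by blast
qed

text \<open>For \<open>N > 0\<close> this is the logarithm of \<open>N! / (N^N * sqrt N)\<close>,
  Stirling's quotient without \<open>exp N\<close>, which would shift the differences between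
  \<open>N\<close> and \<open>N - k\<close> by the constant \<open>k\<close> only.\<close>

definition stirling_ln :: "nat \<Rightarrow> real" where
  "stirling_ln N = ln (fact N) - (real N + 1/2) * ln N"

lemma stirling_ln_diff:
  assumes "M > 0"
  shows "stirling_ln (M + k) - stirling_ln M =
    - (\<Sum>i<k. (real (M + i) + 1/2) * (ln (real (M + i) + 1) - ln (M + i)))"
proof (induction k)
  case (Suc k)
  have "ln (fact (Suc (M + k)) :: real) = ln (real (M + k) + 1) + ln (fact (M + k))"
    by (simp add: ln_mult add.commute)
  then have "stirling_ln (M + Suc k) - stirling_ln (M + k) =
      - ((real (M + k) + 1/2) * (ln (real (M + k) + 1) - ln (M + k)))"
    by (simp add: stirling_ln_def algebra_simps)
  then show ?case using Suc by simp
qed simp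

lemma exp_stirling_ln:
  assumes N: "N > 0"
  shows "exp (stirling_ln N) = fact N / (real N ^ N * sqrt N)"
proof -
  have "stirling_ln N = ln (fact N) - (real N * ln N + ln (sqrt N))"
    using N by (simp add: stirling_ln_def ln_sqrt algebra_simps)
  then show ?thesis using N by (simp add: exp_diff exp_add exp_of_nat_mult)
qed

text \<open>The square root supplies the half powers that complete both \<open>N!\<close> and
  \<open>(N - k)!\<close> to Stirling quotients, so \<open>N\<close> enters through a single
  difference.\<close>

lemma binomial_mean_eq:
  assumes "k < N"
  shows "sqrt (1 - k / N) * (real (N choose k) * (k / N) ^ k * (1 - k / N) ^ (N - k)) =
    real k ^ k / fact k * exp (stirling_ln N - stirling_ln (N - k))"
proof -
  define M where "M = N - k"
  have M: "M > 0" "N = M + k" "N > 0" using assms by (auto simp: M_def)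
  have a: "1 - real k / N = M / N" using M by (simp add: field_simps)
  have b: "real N ^ N = real N ^ k * real N ^ M" using M by (simp add: power_add)
  have c: "real (N choose k) = fact N / (fact k * fact M)"
    using assms by (simp add: binomial_fact M_def)
  show ?thesis unfolding M_def[symmetric] exp_diff exp_stirling_ln[OF M(1)] exp_stirling_ln[OF M(3)] a b c
    by (simp add: power_divide real_sqrt_divide ac_simps)
qed

text \<open>For fixed \<open>k\<close> the difference telescopes into \<open>k\<close> negated terms
  starting at \<open>N - k\<close>; by \<open>ln_succ_div_antimono\<close> each of them grows with
  \<open>N\<close>.\<close>

lemma binomial_mean_mono:
  assumes "k < N" "N \<le> N'"
  shows "sqrt (1 - k / N) * (real (N choose k) * (k / N) ^ k * (1 - k / N) ^ (N - k))
    \<le> sqrt (1 - k / N') * (real (N' choose k) * (k / N') ^ k * (1 - k / N') ^ (N' - k))"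
proof -
  define M M' where "M = N - k" and "M' = N' - k"
  have M: "N = M + k" "N' = M' + k" "0 < M" "M \<le> M'" using assms by (auto simp: M_def M'_def)
  have "(\<Sum>i<k. (real (M' + i) + 1/2) * (ln (real (M' + i) + 1) - ln (M' + i)))
      \<le> (\<Sum>i<k. (real (M + i) + 1/2) * (ln (real (M + i) + 1) - ln (M + i)))"
    using M by (intro sum_mono ln_succ_div_antimono) auto
  then have "stirling_ln (M + k) - stirling_ln M \<le> stirling_ln (M' + k) - stirling_ln M'"
    using M(3,4) by (subst (1 2) stirling_ln_diff) auto
  then have "stirling_ln N - stirling_ln (N - k) \<le> stirling_ln N' - stirling_ln (N' - k)"
    by (simp only: M(1,2) add_diff_cancel_right')
  then have "real k ^ k / fact k * exp (stirling_ln N - stirling_ln (N - k)) \<le>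
      real k ^ k / fact k * exp (stirling_ln N' - stirling_ln (N' - k))"
    by (intro mult_left_mono) auto
  moreover have "k < N'" using assms by simp
  ultimately show ?thesis using assms(1) by (simp only: binomial_mean_eq)
qed

text \<open>The exponents \<open>n * p\<close>, \<open>n * (d - p)\<close> and
  \<open>n * (1 - p)\<close> are natural numbers, so the exponential becomes a product of ordinary
  powers. Both the second lower bound and the upper bound rest on this form.\<close>

lemma exp_Gfun:
  assumes "k \<le> n" "n \<ge> 1" "d \<ge> 1"
  defines "p \<equiv> real k / n"
  shows "exp (2 * real n * Gfun d p) * (p ^ k * (1 - p) ^ (2 * (n - k))) = real d ^ k * (1 - p / d) ^ (n * d - k)"
proof -
  \<comment> \<open>If \<open>x = 0\<close> then \<open>m = 0\<close>, and both sides are 1.\<close>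
  have xln_exp: "exp (c * xln x y) = y ^ m" if "c * x = real m" "c > 0" "x = 0 \<or> y > 0" for c x y and m :: nat
  proof (cases "x = 0")
    case True
    then show ?thesis using that by (simp add: xln_def)
  next
    case False
    then have "exp (c * xln x y) = exp (real m * ln y)" by (simp add: xln_def flip: that(1))
    then show ?thesis using False that by (simp add: exp_of_nat_mult)
  qed
  have n: "real n > 0" using assms by simp
  have p: "0 \<le> p" "p \<le> 1" using assms by (auto simp: p_def)
  have kd: "k \<le> n * d" using assms by (metis le_trans mult.right_neutral mult_le_mono2)
  have np: "real n * p = k" using n by (simp add: p_def)
  have "exp (n * xln p (d / p)) = (d / p) ^ k"
  proof (rule xln_exp[OF np n])
    show "p = 0 \<or> 0 < d / p" using p assms(3) by (cases "p = 0") simp_all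
  qed
  moreover have "exp (n * xln (real d - p) (1 - p / d)) = (1 - p / d) ^ (n * d - k)"
  proof (rule xln_exp[OF _ n])
    show "n * (real d - p) = real (n * d - k)"
      using kd np by (simp add: of_nat_diff right_diff_distrib)
    show "real d - p = 0 \<or> 0 < 1 - p / d" using p assms(3) by (cases "p = d") (simp_all add: field_simps)
  qed
  moreover have "exp (n * xln (1 - p) (1 - p)) = (1 - p) ^ (n - k)"
  proof (rule xln_exp[OF _ n])
    show "n * (1 - p) = real (n - k)"
      using assms(1) np by (simp add: of_nat_diff right_diff_distrib)
  qed (use p in auto)
  moreover have "2 * real n * Gfun d p = n * xln p (d / p) + n * xln (real d - p) (1 - p / d) - (n * xln (1 - p) (1 - p) + n * xln (1 - p) (1 - p))"
    by (simp add: Gfun_def algebra_simps)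
  ultimately have e: "exp (2 * real n * Gfun d p) =
      (d / p) ^ k * (1 - p / d) ^ (n * d - k) / ((1 - p) ^ (n - k) * (1 - p) ^ (n - k))"
    by (simp only: exp_diff exp_add)
  have cancel: "(d / p) ^ k * p ^ k = real d ^ k"
  proof (cases "k = 0")
    case False
    then have "p \<noteq> 0" using n by (simp add: p_def)
    then show ?thesis by (simp flip: power_mult_distrib)
  qed simp
  \<comment> \<open>For \<open>k = n\<close> this power is \<open>0 ^ 0 = 1\<close>.\<close>
  have Q: "(1 - p) ^ (n - k) \<noteq> 0"
    using n assms(1) by (cases "k = n") (auto simp: p_def)
  have prod: "exp (2 * real n * Gfun d p) * (p ^ k * (1 - p) ^ (2 * (n - k))) =
      (d / p) ^ k * (1 - p / d) ^ (n * d - k) / ((1 - p) ^ (n - k) * (1 - p) ^ (n - k)) *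
      (p ^ k * ((1 - p) ^ (n - k) * (1 - p) ^ (n - k)))"
    by (simp only: e mult_2[of "n - k"] power_add)
  have arith: "x * r / (q * q) * (y * (q * q)) = x * y * r" if "q \<noteq> 0" for x y q r :: real
    using that by simp
  show ?thesis unfolding prod arith[OF Q] cancel ..
qed

text \<open>One term of the expansion of \<open>(p + (1 - p)) ^ n\<close>. This makes the second
  lower bound a consequence of the first.\<close>

lemma p_mu_le_1:
  assumes "k \<le> n" "n \<ge> 1"
  shows "0 \<le> p_mu n k" "p_mu n k \<le> 1"
proof -
  define p where "p = real k / n"
  have p: "0 \<le> p" "p \<le> 1" using assms by (auto simp: p_def)
  then show "0 \<le> p_mu n k" unfolding p_mu_def p_def[symmetric] by simp
  have "p_mu n k \<le> (\<Sum>i\<le>n. real (n choose i) * p ^ i * (1 - p) ^ (n - i))"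
    unfolding p_mu_def p_def[symmetric] using assms p by (intro member_le_sum) auto
  also have "\<dots> = (p + (1 - p)) ^ n" by (rule binomial_ring[symmetric])
  finally show "p_mu n k \<le> 1" by simp
qed

lemma rpow_of_nat: "x \<ge> 0 \<Longrightarrow> rpow x (real m) = x ^ m"
  by (auto simp: rpow_def powr_realpow)

section \<open>Regular graphs with few matchings\<close>

text \<open>A block of \<open>d\<close> consecutive numbers holds the half-edges of one vertex.
  Every set counted is the image of a choice function on the \<open>k\<close> blocks that it
  meets.\<close>

lemma card_div_transversals:
  fixes n d k :: nat
  assumes "d \<ge> 1"
  shows "card {M. M \<subseteq> {..<n * d} \<and> card M = k \<and> inj_on (\<lambda>e. e div d) M} \<le> (n choose k) * d ^ k"
    (is "card ?F \<le> _")
proof -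
  let ?I = "SIGMA T:{T. T \<subseteq> {..<n} \<and> card T = k}. Pi\<^sub>E T (\<lambda>i. {i * d..<i * d + d})"
  have fin: "finite {T. T \<subseteq> {..<n} \<and> card T = k}" by simp
  have finT: "finite T" if "T \<subseteq> {..<n}" for T using that finite_subset by blast
  have "?F \<subseteq> (\<lambda>(T, f). f ` T) ` ?I"
  proof
    fix M assume "M \<in> ?F"
    then have M: "M \<subseteq> {..<n * d}" "card M = k" and inj: "inj_on (\<lambda>e. e div d) M" by auto
    define T where "T = (\<lambda>e. e div d) ` M"
    define f where "f = restrict (the_inv_into M (\<lambda>e. e div d)) T"
    have fe: "f (e div d) = e" if "e \<in> M" for e
      using that the_inv_into_f_f[OF inj that] by (simp add: f_def T_def)
    have "f ` T = M" by (simp add: T_def image_image fe cong: image_cong)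
    moreover have "T \<subseteq> {..<n}" using M assms by (auto simp: T_def less_mult_imp_div_less)
    moreover have "card T = k" using M inj by (simp add: T_def card_image)
    moreover have "f \<in> Pi\<^sub>E T (\<lambda>i. {i * d..<i * d + d})"
    proof (rule PiE_I)
      fix i assume "i \<in> T"
      then have "f i div d = i" using fe by (auto simp: T_def)
      then have "f i = i * d + f i mod d" using div_mult_mod_eq[of "f i" d] by simp
      moreover have "f i mod d < d" using assms by simp
      ultimately show "f i \<in> {i * d..<i * d + d}" by (metis atLeastLessThan_iff le_add1 nat_add_left_cancel_less)
    qed (simp add: f_def)
    ultimately show "M \<in> (\<lambda>(T, f). f ` T) ` ?I" by (intro image_eqI[of _ _ "(T, f)"]) auto
  qed
  moreover have finI: "finite ?I" using finT by (intro finite_SigmaI fin finite_PiE) auto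
  ultimately have "card ?F \<le> card ?I" by (meson card_image_le card_mono finite_imageI le_trans)
  also have "\<dots> = (\<Sum>T | T \<subseteq> {..<n} \<and> card T = k. d ^ k)"
    using fin finT by (subst card_SigmaI) (auto simp: card_PiE finite_PiE)
  also have "\<dots> = (n choose k) * d ^ k" by (simp add: n_subsets)
  finally show ?thesis .
qed

text \<open>Composition with a permutation taking \<open>T\<close> to \<open>T'\<close> injects one
  class of permutations into the other, so all classes have equal size; together they exhaust the
  permutations of \<open>U\<close>.\<close>

lemma card_permutes_image_eq:
  assumes U: "finite U" and M: "M \<subseteq> U" "card M = k" and T: "T \<subseteq> U" "card T = k"
  shows "card {\<pi>. \<pi> permutes U \<and> \<pi> ` M = T} * (card U choose k) = fact (card U)"
proof -
  let ?c = "\<lambda>T. card {\<pi>. \<pi> permutes U \<and> \<pi> ` M = T}"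
  let ?K = "{T. T \<subseteq> U \<and> card T = k}"
  have le: "?c T \<le> ?c T'" if T: "T \<in> ?K" and T': "T' \<in> ?K" for T T'
  proof -
    have fin: "finite T" "finite T'" "finite (U - T)" "finite (U - T')"
      using T T' U finite_subset by auto
    obtain f where f: "bij_betw f T T'" using finite_same_card_bij[OF fin(1,2)] T T' by auto
    have "card (U - T) = card (U - T')" using T T' fin by (simp add: card_Diff_subset)
    then obtain g where g: "bij_betw g (U - T) (U - T')" using finite_same_card_bij[OF fin(3,4)] by auto
    define s where "s x = (if x \<in> T then f x else if x \<in> U then g x else x)" for x
    have "bij_betw s T T'" using f bij_betw_cong[of T s f T'] by (simp add: s_def)
    moreover have "bij_betw s (U - T) (U - T')" using g bij_betw_cong[of "U - T" s g "U - T'"] by (simp add: s_def)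
    ultimately have "bij_betw s (T \<union> (U - T)) (T' \<union> (U - T'))" by (rule bij_betw_combine) auto
    moreover have "T \<union> (U - T) = U" "T' \<union> (U - T') = U" using T T' by auto
    ultimately have s: "s permutes U"
      using T by (auto intro!: bij_imp_permutes simp: s_def)
    have sT: "s ` T = T'" using \<open>bij_betw s T T'\<close> by (simp add: bij_betw_def)
    show ?thesis
    proof (rule card_inj_on_le)
      show "inj_on (\<lambda>\<pi>. s \<circ> \<pi>) {\<pi>. \<pi> permutes U \<and> \<pi> ` M = T}"
        using permutes_inj[OF s] by (intro inj_onI) (auto simp: fun_eq_iff inj_eq)
      show "(\<lambda>\<pi>. s \<circ> \<pi>) ` {\<pi>. \<pi> permutes U \<and> \<pi> ` M = T} \<subseteq> {\<pi>. \<pi> permutes U \<and> \<pi> ` M = T'}"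
        using s sT by (auto simp: permutes_compose image_comp[symmetric])
      show "finite {\<pi>. \<pi> permutes U \<and> \<pi> ` M = T'}"
        using finite_permutations[OF U] by (rule rev_finite_subset) auto
    qed
  qed
  have "fact (card U) = card {\<pi>. \<pi> permutes U}" using U by (simp add: card_permutations)
  also have "\<dots> = (\<Sum>\<pi> | \<pi> permutes U. 1)" by simp
  also have "\<dots> = (\<Sum>T'\<in>?K. \<Sum>\<pi> | \<pi> \<in> {\<pi>. \<pi> permutes U} \<and> \<pi> ` M = T'. 1)"
  proof (rule sum.group[symmetric])
    show "finite {\<pi>. \<pi> permutes U}" using finite_permutations[OF U] .
    show "finite ?K" using U by simp
    show "(\<lambda>\<pi>. \<pi> ` M) ` {\<pi>. \<pi> permutes U} \<subseteq> ?K"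
      using M by (auto simp: permutes_in_image card_image[OF permutes_inj_on])
  qed
  also have "\<dots> = (\<Sum>T'\<in>?K. ?c T')" by simp
  also have "\<dots> = (\<Sum>T'\<in>?K. ?c T)" using le T by (intro sum.cong order.antisym) auto
  also have "\<dots> = ?c T * (card U choose k)" using n_subsets[OF U] by (simp add: mult.commute)
  finally show ?thesis by simp
qed

text \<open>Averaging over the configuration model: cut each vertex of either side into \<open>d\<close> half-edges and
  join the half-edges along a uniformly random permutation.\<close>

lemma ex_regular_few_matchings:
  fixes n d k :: nat
  assumes d: "d \<ge> 1"
  obtains E ends where "bip_regular n d E ends"
    and "num_matchings E ends k * (n * d choose k) \<le> ((n choose k) * d ^ k) ^ 2"
proof -
  define U where "U = {..<n * d}"
  define F where "F = {M. M \<subseteq> U \<and> card M = k \<and> inj_on (\<lambda>e. e div d) M}"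
  define G :: "(nat \<Rightarrow> nat) \<Rightarrow> nat \<Rightarrow> nat \<times> nat" where "G = (\<lambda>\<pi> e. (e div d, \<pi> e div d))"
  let ?P = "{\<pi>. \<pi> permutes U}"
  let ?N = "n * d choose k"
  have U: "finite U" "card U = n * d" by (auto simp: U_def)
  have F: "finite F" by (rule finite_subset[of _ "Pow U"]) (auto simp: F_def U)
  have P: "finite ?P" "card ?P = fact (n * d)" using U by (simp_all add: finite_permutations card_permutations)
  \<comment> \<open>\<open>M\<close> is a matching exactly when \<open>M\<close> and its image under
    \<open>\<pi>\<close> both meet each block at most once.\<close>
  have nm: "num_matchings U (G \<pi>) k = card {M\<in>F. \<pi> ` M \<in> F}" if "\<pi> permutes U" for \<pi>
  proof -
    have inj: "inj_on (\<lambda>e. \<pi> e div d) M \<longleftrightarrow> inj_on (\<lambda>e. e div d) (\<pi> ` M)" for M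
      using comp_inj_on_iff[OF permutes_inj_on[OF that], of "\<lambda>e. e div d" M] by (simp add: o_def)
    have "M \<in> matchings U (G \<pi>) k \<longleftrightarrow> M \<in> F \<and> inj_on (\<lambda>e. \<pi> e div d) M" for M
      unfolding matchings_def F_def G_def inj_on_def fst_conv snd_conv mem_Collect_eq by blast
    moreover have "\<pi> ` M \<in> F \<longleftrightarrow> inj_on (\<lambda>e. \<pi> e div d) M" if "M \<in> F" for M
      using that \<open>\<pi> permutes U\<close> unfolding inj
      by (auto simp: F_def permutes_in_image card_image[OF permutes_inj_on])
    ultimately have "matchings U (G \<pi>) k = {M\<in>F. \<pi> ` M \<in> F}" by blast
    then show ?thesis by (simp add: num_matchings_def)
  qed
  have "(\<Sum>\<pi>\<in>?P. num_matchings U (G \<pi>) k) = (\<Sum>\<pi>\<in>?P. \<Sum>M\<in>F. of_bool (\<pi> ` M \<in> F))"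
    using F by (intro sum.cong) (auto simp: nm sum.If_cases of_bool_def Int_def)
  also have "\<dots> = (\<Sum>M\<in>F. \<Sum>\<pi>\<in>?P. of_bool (\<pi> ` M \<in> F))" by (rule sum.swap)
  also have "\<dots> = (\<Sum>M\<in>F. \<Sum>T\<in>F. card {\<pi>. \<pi> permutes U \<and> \<pi> ` M = T})"
  proof (rule sum.cong)
    fix M assume "M \<in> F"
    have "(\<Sum>\<pi>\<in>?P. of_bool (\<pi> ` M \<in> F)) = (\<Sum>\<pi>\<in>?P. \<Sum>T\<in>F. of_bool (\<pi> ` M = T))"
      using F by (intro sum.cong) (auto simp: of_bool_def)
    also have "\<dots> = (\<Sum>T\<in>F. \<Sum>\<pi>\<in>?P. of_bool (\<pi> ` M = T))" by (rule sum.swap)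
    also have "\<dots> = (\<Sum>T\<in>F. card {\<pi>. \<pi> permutes U \<and> \<pi> ` M = T})"
      using P by (intro sum.cong) (auto simp: of_bool_def sum.If_cases Int_def)
    finally show "(\<Sum>\<pi>\<in>?P. of_bool (\<pi> ` M \<in> F)) = (\<Sum>T\<in>F. card {\<pi>. \<pi> permutes U \<and> \<pi> ` M = T})" .
  qed simp
  finally have "(\<Sum>\<pi>\<in>?P. num_matchings U (G \<pi>) k) * ?N =
      (\<Sum>M\<in>F. \<Sum>T\<in>F. card {\<pi>. \<pi> permutes U \<and> \<pi> ` M = T} * ?N)"
    by (simp only: sum_distrib_right)
  \<comment> \<open>Every pair of transversals contributes equally, so the average number of
    matchings times \<open>?N\<close> is \<open>(card F) ^ 2\<close>.\<close>
  also have "\<dots> = (\<Sum>M\<in>F. \<Sum>T\<in>F. fact (n * d))"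
  proof (intro sum.cong refl)
    fix M T assume "M \<in> F" "T \<in> F"
    then show "card {\<pi>. \<pi> permutes U \<and> \<pi> ` M = T} * ?N = fact (n * d)"
      using card_permutes_image_eq[OF U(1), of M k T] by (simp add: F_def U)
  qed
  also have "\<dots> = (\<Sum>\<pi>\<in>?P. (card F) ^ 2)" using P by (simp add: power2_eq_square)
  finally have sum: "(\<Sum>\<pi>\<in>?P. num_matchings U (G \<pi>) k * ?N) = (\<Sum>\<pi>\<in>?P. (card F) ^ 2)"
    by (simp only: sum_distrib_right)
  \<comment> \<open>Some permutation does not exceed the average; the identity shows that
    \<open>?P\<close> is nonempty.\<close>
  have "\<exists>\<pi>\<in>?P. num_matchings U (G \<pi>) k * ?N \<le> (card F) ^ 2"
  proof (rule ccontr)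
    assume "\<not> ?thesis"
    then have "(\<Sum>\<pi>\<in>?P. (card F) ^ 2) < (\<Sum>\<pi>\<in>?P. num_matchings U (G \<pi>) k * ?N)"
      using P(1) permutes_id[of U] by (intro sum_strict_mono) (auto simp: not_le simp del: permutes_id)
    then show False using sum by simp
  qed
  then obtain \<pi> where \<pi>: "\<pi> permutes U" and le: "num_matchings U (G \<pi>) k * ?N \<le> (card F) ^ 2" by blast
  have block: "card {e\<in>U. e div d = i} = d" if "i < n" for i
  proof -
    have "{e\<in>U. e div d = i} = {i * d..<i * d + d}"
    proof (intro equalityI subsetI)
      fix e assume "e \<in> {e\<in>U. e div d = i}"
      then have "e = i * d + e mod d" using div_mult_mod_eq[of e d] by simp
      moreover have "e mod d < d" using d by simp
      ultimately show "e \<in> {i * d..<i * d + d}" by (metis atLeastLessThan_iff le_add1 nat_add_left_cancel_less)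
    next
      fix e assume e: "e \<in> {i * d..<i * d + d}"
      then have "e div d = i" using d by (intro div_nat_eqI) (auto simp: mult.commute)
      moreover have "Suc i * d \<le> n * d" using that by (intro mult_le_mono1) simp
      ultimately show "e \<in> {e\<in>U. e div d = i}" using e by (auto simp: U_def)
    qed
    then show ?thesis by simp
  qed
  have "card {e\<in>U. \<pi> e div d = j} = d" if "j < n" for j
  proof -
    have "\<pi> ` {e\<in>U. \<pi> e div d = j} = {e\<in>U. e div d = j}"
    proof (intro equalityI subsetI)
      fix x assume "x \<in> {e\<in>U. e div d = j}"
      then show "x \<in> \<pi> ` {e\<in>U. \<pi> e div d = j}"
        using permutes_inverses(1)[OF \<pi>, of x] permutes_in_image[OF permutes_inv[OF \<pi>], of x]
        by (intro image_eqI[of _ _ "inv \<pi> x"]) auto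
    next
      fix x assume "x \<in> \<pi> ` {e\<in>U. \<pi> e div d = j}"
      then obtain e where "e \<in> U" "\<pi> e div d = j" "x = \<pi> e" by blast
      then show "x \<in> {e\<in>U. e div d = j}" using permutes_in_image[OF \<pi>, of e] by simp
    qed
    then show ?thesis using block[OF that] card_image[OF permutes_inj_on[OF \<pi>]] by metis
  qed
  moreover have "\<pi> e < n * d" if "e \<in> U" for e
    using permutes_in_image[OF \<pi>, of e] that by (simp add: U_def)
  ultimately have "bip_regular n d U (G \<pi>)"
    using block U by (auto simp: bip_regular_def G_def U_def less_mult_imp_div_less)
  moreover have "num_matchings U (G \<pi>) k * ?N \<le> ((n choose k) * d ^ k) ^ 2"
    using le card_div_transversals[OF d, of n k] unfolding F_def U_def by (meson le_trans power_mono zero_le)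
  ultimately show ?thesis using that by blast
qed

text \<open>Once \<open>X\<close> is replaced through \<open>exp_Gfun\<close>, the claim reduces to
  \<open>a * C * q * D <= b * N * r\<close>. This is \<open>binomial_mean_mono\<close> between
  \<open>n\<close> and \<open>n * d\<close>, up to the positive factor
  \<open>D / p ^ k\<close>.\<close>

lemma few_matchings_bound:
  fixes m :: nat
  assumes k: "k < n" and d: "d \<ge> 1" and m: "m * (n * d choose k) \<le> ((n choose k) * d ^ k) ^ 2"
  defines "p \<equiv> real k / n"
  shows "m \<le> sqrt ((1 - p / d) / (1 - p)) * p_mu n k * exp (2 * real n * Gfun d p)"
proof -
  define a b q r X C D where "a = sqrt (1 - p)" and "b = sqrt (1 - p / d)"
    and "q = (1 - p) ^ (n - k)" and "r = (1 - p / d) ^ (n * d - k)" and "X = exp (2 * real n * Gfun d p)"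
    and "C = real (n choose k)" and "D = real d ^ k"
  define N where "N = real (n * d choose k)"
  have n: "n \<ge> 1" "real n > 0" using k by auto
  have p: "0 \<le> p" "p < 1" using k by (auto simp: p_def)
  have kd: "n \<le> n * d" using d by (cases d) auto
  then have kd': "k < n * d" by (rule less_le_trans[OF k])
  have pos: "a > 0" "q > 0" "D > 0" "N > 0" "C > 0" 
    using p d k kd' by (simp_all add: a_def q_def D_def N_def C_def zero_less_binomial)
  \<comment> \<open>For \<open>k = 0\<close> the power is \<open>0 ^ 0 = 1\<close>.\<close>
  have pk: "p ^ k > 0" using k by (cases "k = 0") (auto simp: p_def)
  have q2: "q * q = (1 - p) ^ (2 * (n - k))" by (simp only: q_def mult_2 power_add)
  have id: "X * (p ^ k * (q * q)) = D * r"
    unfolding q2 X_def D_def r_def p_def using k n(1) d by (intro exp_Gfun) simp_all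
  have kN: "k / real (n * d) = p / d" by (simp add: p_def)
  have pd: "(p / d) ^ k * D = p ^ k" using d by (simp add: D_def power_divide)
  have "a * (C * p ^ k * q) \<le> b * (N * (p / d) ^ k * r)"
    using binomial_mean_mono[OF k kd] unfolding a_def b_def C_def N_def q_def r_def kN p_def .
  then have "a * (C * p ^ k * q) * D \<le> b * (N * (p / d) ^ k * r) * D"
    using pos(3) by (intro mult_right_mono) simp_all
  also have "\<dots> = b * N * r * ((p / d) ^ k * D)" by (simp only: ac_simps)
  also have "\<dots> = p ^ k * (b * N * r)" unfolding pd by (simp only: ac_simps)
  finally have "p ^ k * (a * C * q * D) \<le> p ^ k * (b * N * r)" by (simp only: ac_simps)
  then have "a * C * q * D \<le> b * N * r" using pk by (simp only: mult_le_cancel_left_pos)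
  then have "a * C * q * D * (C * D) \<le> b * N * r * (C * D)"
    using pos by (intro mult_right_mono) simp_all
  also have "\<dots> = q * (b * N * C * (X * p ^ k * q))"
  proof -
    have "b * N * r * (C * D) = b * N * C * (D * r)" by (simp only: ac_simps)
    also have "\<dots> = q * (b * N * C * (X * p ^ k * q))" unfolding id[symmetric] by (simp only: ac_simps)
    finally show ?thesis .
  qed
  finally have "q * (a * (C * D) ^ 2) \<le> q * (b * N * C * (X * p ^ k * q))"
    by (simp only: power2_eq_square ac_simps)
  then have *: "a * (C * D) ^ 2 \<le> b * N * C * (X * p ^ k * q)" using pos(2) by (simp only: mult_le_cancel_left_pos)
  have "real (m * (n * d choose k)) \<le> real (((n choose k) * d ^ k) ^ 2)" using m by (rule of_nat_mono)
  then have "m * N \<le> (C * D) ^ 2" by (simp add: N_def C_def D_def)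
  then have "a * (m * N) \<le> a * (C * D) ^ 2" using pos(1) by (simp only: mult_le_cancel_left_pos)
  then have "a * (m * N) \<le> b * N * C * (X * p ^ k * q)" using * by (rule order_trans)
  then have "N * (a * m) \<le> N * (b * (C * p ^ k * q) * X)" by (simp only: ac_simps)
  then have "a * m \<le> b * (C * p ^ k * q) * X" using pos(4) by (simp only: mult_le_cancel_left_pos)
  then have "m \<le> b * (C * p ^ k * q) * X / a" using pos(1) by (simp only: pos_le_divide_eq mult.commute)
  also have "C * p ^ k * q = p_mu n k" by (simp only: p_mu_def C_def q_def p_def)
  finally show ?thesis by (simp add: a_def b_def X_def real_sqrt_divide del: real_sqrt_eq_iff)
qed

section \<open>The empty matching and the assembly of the bounds\<close>

lemma num_matchings_0:
  assumes "finite E"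
  shows "num_matchings E ends 0 = 1"
proof -
  have "matchings E ends 0 = {{}}"
    using finite_subset[OF _ assms] by (auto simp: matchings_def)
  then show ?thesis by (simp add: num_matchings_def)
qed

theorem theorem1p5:
  fixes n d :: nat
  assumes "n \<ge> 1" and "d \<ge> 1"
  shows "(\<forall>k\<le>n. \<forall>E ends. bip_regular n d E ends \<longrightarrow>
            (let p = real k / real n in
              real (num_matchings E ends k) \<ge> p_mu n k * exp (2 * real n * Gfun d p) \<and>
              real (num_matchings E ends k) \<ge>
                real (n choose k) ^ 2 * rpow ((real d - p) / real d) (real n * (real d - p))
                  * rpow (real d * p) (real n * p)))
       \<and> (\<forall>k<n. \<exists>E ends. bip_regular n d E ends \<and>
            (let p = real k / real n in
              real (num_matchings E ends k) \<le>
                sqrt ((1 - p / real d) / (1 - p)) * p_mu n k * exp (2 * real n * Gfun d p)))"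
proof (intro conjI allI impI)
  fix k E ends assume k: "k \<le> n" and reg: "bip_regular n d E ends"
  define p where "p = real k / n"
  let ?m = "real (num_matchings E ends k)"
  have n: "real n > 0" using assms by simp
  have lower: "p_mu n k * exp (2 * real n * Gfun d p) \<le> ?m"
  proof (cases "k = 0")
    \<comment> \<open>The capacity argument asks for \<open>p > 0\<close>. Here the empty matching
      is the only one, \<open>p_mu n 0 = 1\<close> and \<open>Gfun d 0 = 0\<close>.\<close>
    case True
    have "num_matchings E ends k = 1" using reg True by (simp add: bip_regular_def num_matchings_0)
    then show ?thesis using True assms by (simp add: p_mu_def p_def Gfun_def xln_def)
  next
    case False
    then show ?thesis using num_matchings_lower[OF reg assms(2) _ k] by (simp add: p_def)
  qed
  have np: "real n * p = k" using n by (simp add: p_def)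
  have p: "0 \<le> p" "p \<le> 1" using k n by (auto simp: p_def)
  have kd: "k \<le> n * d" using k assms(2) by (metis le_trans mult.right_neutral mult_le_mono2)
  have e: "real n * (real d - p) = real (n * d - k)" using kd np by (simp add: of_nat_diff right_diff_distrib)
  have f: "(real d - p) / d = 1 - p / d" using assms(2) by (simp add: diff_divide_distrib)
  have "1 - p / d \<ge> 0" "real d * p \<ge> 0" using p assms(2) by (auto simp: field_simps)
  \<comment> \<open>By \<open>exp_Gfun\<close> the second bound is \<open>p_mu n k\<close> times the
    first, and a probability is at most 1.\<close>
  then have "real (n choose k) ^ 2 * rpow ((real d - p) / d) (real n * (real d - p)) * rpow (real d * p) (real n * p) =
      real (n choose k) ^ 2 * (1 - p / d) ^ (n * d - k) * (d * p) ^ k"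
    unfolding e f np by (simp only: rpow_of_nat)
  also have "\<dots> = real (n choose k) ^ 2 * p ^ k * (real d ^ k * (1 - p / d) ^ (n * d - k))"
    by (simp only: power_mult_distrib ac_simps)
  also have "real d ^ k * (1 - p / d) ^ (n * d - k) = exp (2 * real n * Gfun d p) * (p ^ k * (1 - p) ^ (2 * (n - k)))"
    using exp_Gfun[OF k assms] by (simp only: p_def)
  also have "real (n choose k) ^ 2 * p ^ k * \<dots> = p_mu n k * (p_mu n k * exp (2 * real n * Gfun d p))"
    unfolding p_mu_def p_def[symmetric] power2_eq_square mult_2 power_add by (simp only: ac_simps)
  also have "\<dots> \<le> 1 * (p_mu n k * exp (2 * real n * Gfun d p))"
    using p_mu_le_1[OF k assms(1)] by (intro mult_right_mono) auto
  finally show "let p = real k / real n in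
              ?m \<ge> p_mu n k * exp (2 * real n * Gfun d p) \<and>
              ?m \<ge> real (n choose k) ^ 2 * rpow ((real d - p) / real d) (real n * (real d - p))
                  * rpow (real d * p) (real n * p)"
    using lower by (simp add: p_def[symmetric])
next
  fix k assume k: "k < n"
  obtain E ends where "bip_regular n d E ends"
    and "num_matchings E ends k * (n * d choose k) \<le> ((n choose k) * d ^ k) ^ 2"
    using ex_regular_few_matchings[OF assms(2)] by blast
  then show "\<exists>E ends. bip_regular n d E ends \<and>
            (let p = real k / real n in
              real (num_matchings E ends k) \<le>
                sqrt ((1 - p / real d) / (1 - p)) * p_mu n k * exp (2 * real n * Gfun d p))"
    using few_matchings_bound[OF k assms(2)] unfolding Let_def by blast
qed

end
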